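(* Let $N\ge1$ and $u\in\mathrm{BV}^2(\mathbb{R}^N)$, and let $\mu_n:=H_nu\,\mathcal{L}^N$ be the $\mathbb{R}^{N\times N}$-valued finite Radon measure with density $H_nu$ with respect to Lebesgue measure. Then $\mu_n\to D^2u$ weakly$^\ast$ as $n\to\infty$, i.e., for every $\phi\in C_0(\mathbb{R}^N,\mathbb{R}^{N\times N})$, $$\lim_{n\to\infty}\int_{\mathbb{R}^N}H_nu(x)\cdot\phi(x)\,dx=\int_{\mathbb{R}^N}\phi(x)\cdot dD^2u.$$
   Context: Standing assumptions: $(\rho_n)_{n\in\mathbb{N}}$ is a sequence of radial functions on $\mathbb{R}^N$ such that for all $n$: $\rho_n\ge 0$, $\int_{\mathbb{R}^N}\rho_n(x)\,dx=1$, and $\lim_{n\to\infty}\int_{|x|>\gamma}\rho_n(x)\,dx=0$ for every $\gamma>0$. $\mathrm{BV}^2(\mathbb{R}^N)$ is the space of functions $u\in W^{1,1}(\mathbb{R}^N)$ such that $\nabla u\in\mathrm{BV}(\mathbb{R}^N,\mathbb{R}^N)$; $D^2u:=D(\nabla u)$ is the resulting $\mathbb{R}^{N\times N}$-valued finite Radon measure (the second order distributional derivative). Non-local Hessian (a Lebesgue integral, defined for almost every $x$ when $u\in\mathrm{BV}^2(\mathbb{R}^N)$, and then $H_nu\in L^1(\mathbb{R}^N,\mathbb{R}^{N\times N})$): $$H_nu(x):=\frac{N(N+2)}{2}\int_{\mathbb{R}^N}\frac{u(x+h)-2u(x)+u(x-h)}{|h|^2}\,\frac{h\otimes h-\frac{|h|^2}{N+2}I_N}{|h|^2}\,\rho_n(h)\,dh,$$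 where $I_N$ is the $N\times N$ identity matrix and $h\otimes h=hh^{\top}$. For matrices, $A\cdot B=\sum_{i,j=1}^NA_{ij}B_{ij}$, and $\int\phi\cdot dD^2u=\sum_{i,j}\int\phi_{ij}\,d(D^2u)_{ij}$. $C_0(\mathbb{R}^N,\mathbb{R}^{N\times N})$ is the space of continuous functions vanishing at infinity. *)

theory Defs
  imports "HOL-Analysis.Analysis"
begin

text \<open>Elements of Lebesgue and Sobolev spaces are represented by functions (not by classes modulo
  null sets) that are measurable with respect to \<^const>\<open>lebesgue\<close>. The dimension \<open>N\<close> is
  \<open>CARD('n)\<close>.\<close>

definition partial_deriv :: "'n::finite \<Rightarrow> (real^'n \<Rightarrow> real) \<Rightarrow> real^'n \<Rightarrow> real" where
  "partial_deriv i f x = frechet_derivative f (at x) (axis i 1)"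

primrec C_k :: "nat \<Rightarrow> (real^'n::finite \<Rightarrow> real) \<Rightarrow> bool" where
  "C_k 0 f \<longleftrightarrow> continuous_on UNIV f"
| "C_k (Suc k) f \<longleftrightarrow> f differentiable_on UNIV \<and> (\<forall>i. C_k k (partial_deriv i f))"

definition test_functions :: "(real^'n::finite \<Rightarrow> real) set" where
  "test_functions = {\<psi>. (\<forall>k. C_k k \<psi>) \<and> compact (closure {x. \<psi> x \<noteq> 0})}"


subsection \<open>Finite signed and vector-valued Borel measures\<close>

text \<open>A finite (real or vector-valued) Radon measure on a Euclidean space is a countably additive
  set function on the Borel sets; finiteness of the total variation and regularity are automatic.
  The values on non-Borel sets are irrelevant. Taking all \<open>A i\<close> empty gives \<open>\<mu> {} = 0\<close>.\<close>

definition finite_radon_measure ::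
    "('a::euclidean_space set \<Rightarrow> 'b::euclidean_space) \<Rightarrow> bool" where
  "finite_radon_measure \<mu> \<longleftrightarrow>
     (\<forall>A :: nat \<Rightarrow> 'a set. range A \<subseteq> sets borel \<longrightarrow> disjoint_family A \<longrightarrow>
        (\<lambda>i. \<mu> (A i)) sums \<mu> (\<Union>i. A i))"

text \<open>The positive part \<open>m\<^sup>+(A) = sup {m(B) | B \<subseteq> A Borel}\<close> of the Jordan decomposition
  (\<open>B = {}\<close> is admitted, so truncating negative values by \<^const>\<open>ennreal\<close> is harmless).
  The negative part is the positive part of \<open>- m\<close>.\<close>

definition positive_variation :: "('a::euclidean_space set \<Rightarrow> real) \<Rightarrow> 'a measure" where
  "positive_variation m =
     measure_of UNIV (sets borel) (\<lambda>A. SUP B\<in>{B \<in> sets borel. B \<subseteq> A}. ennreal (m B))"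

definition signed_integral ::
    "('a::euclidean_space set \<Rightarrow> real) \<Rightarrow> ('a \<Rightarrow> real) \<Rightarrow> real" where
  "signed_integral m f =
     integral\<^sup>L (positive_variation m) f - integral\<^sup>L (positive_variation (\<lambda>A. - m A)) f"

definition matrix_integral ::
    "((real^'n::finite) set \<Rightarrow> real^'n^'n) \<Rightarrow> (real^'n \<Rightarrow> real^'n^'n) \<Rightarrow> real" where
  "matrix_integral \<mu> \<phi> =
     (\<Sum>i\<in>UNIV. \<Sum>j\<in>UNIV. signed_integral (\<lambda>A. \<mu> A $ i $ j) (\<lambda>x. \<phi> x $ i $ j))"


subsection \<open>Sobolev functions, functions of bounded variation, and their second-order analogue\<close>

definition has_weak_gradient ::
    "(real^'n::finite \<Rightarrow> real) \<Rightarrow> (real^'n \<Rightarrow> real^'n) \<Rightarrow> bool" where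
  "has_weak_gradient u g \<longleftrightarrow> integrable lebesgue u \<and> integrable lebesgue g \<and>
     (\<forall>\<psi>\<in>test_functions. \<forall>i.
        (LINT x|lebesgue. u x * partial_deriv i \<psi> x) = - (LINT x|lebesgue. g x $ i * \<psi> x))"

definition W11 :: "(real^'n::finite \<Rightarrow> real) set" where
  "W11 = {u. \<exists>g. has_weak_gradient u g}"

text \<open>\<open>has_derivative_measure v D\<close> means \<open>Dv = D\<close>, with the convention
  \<open>(Dv)\<^sub>i\<^sub>j = D\<^sub>j v\<^sub>i\<close>.\<close>

definition has_derivative_measure ::
    "(real^'n::finite \<Rightarrow> real^'n) \<Rightarrow> ((real^'n) set \<Rightarrow> real^'n^'n) \<Rightarrow> bool" where
  "has_derivative_measure v D \<longleftrightarrow> integrable lebesgue v \<and> finite_radon_measure D \<and>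
     (\<forall>\<psi>\<in>test_functions. \<forall>i j.
        (LINT x|lebesgue. v x $ i * partial_deriv j \<psi> x) =
          - signed_integral (\<lambda>A. D A $ i $ j) \<psi>)"

definition BV_vector :: "(real^'n::finite \<Rightarrow> real^'n) set" where
  "BV_vector = {v. \<exists>D. has_derivative_measure v D}"

definition BV2 :: "(real^'n::finite \<Rightarrow> real) set" where
  "BV2 = {u \<in> W11. \<exists>g. has_weak_gradient u g \<and> g \<in> BV_vector}"

text \<open>\<open>has_hessian_measure u D\<close> means \<open>D\<^sup>2u = D(\<nabla>u) = D\<close>. The weak gradient is
  determined up to a null set and \<open>D\<close> is determined on all Borel sets.\<close>

definition has_hessian_measure ::
    "(real^'n::finite \<Rightarrow> real) \<Rightarrow> ((real^'n) set \<Rightarrow> real^'n^'n) \<Rightarrow> bool" where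
  "has_hessian_measure u D \<longleftrightarrow> (\<exists>g. has_weak_gradient u g \<and> has_derivative_measure g D)"


subsection \<open>The non-local Hessian\<close>

definition outer_product :: "real^'n::finite \<Rightarrow> real^'n \<Rightarrow> real^'n^'n" where
  "outer_product a b = (\<chi> i j. a $ i * b $ j)"

text \<open>The integrand at \<open>h = 0\<close> is \<open>0\<close> because division by zero yields zero; this affects only a
  null set.\<close>

definition hessian_integrand ::
    "(real^'n::finite \<Rightarrow> real) \<Rightarrow> (real^'n \<Rightarrow> real) \<Rightarrow> real^'n \<Rightarrow> real^'n \<Rightarrow> real^'n^'n" where
  "hessian_integrand r u x h =
     ((u (x + h) - 2 * u x + u (x - h)) / (norm h)\<^sup>2 * r h) *\<^sub>R
       ((1 / (norm h)\<^sup>2) *\<^sub>R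
         (outer_product h h - ((norm h)\<^sup>2 / (real CARD('n) + 2)) *\<^sub>R mat 1))"

definition nonlocal_hessian ::
    "(real^'n::finite \<Rightarrow> real) \<Rightarrow> (real^'n \<Rightarrow> real) \<Rightarrow> real^'n \<Rightarrow> real^'n^'n" where
  "nonlocal_hessian r u x =
     (real CARD('n) * (real CARD('n) + 2) / 2) *\<^sub>R (LINT h|lebesgue. hessian_integrand r u x h)"

definition C0_matrix :: "(real^'n::finite \<Rightarrow> real^'n^'n) set" where
  "C0_matrix = {\<phi>. continuous_on UNIV \<phi> \<and> (\<phi> \<longlongrightarrow> 0) at_infinity}"

end

theory Submission
  imports Defs
begin

text \<open>
  Pairing the non-local Hessian with a test function moves everything onto second differences. Write
  \<open>\<Delta>\<^sub>h u(x) = u(x + h) - 2 u(x) + u(x - h)\<close> and \<open>G(h) = \<integral> \<Delta>\<^sub>h u \<cdot> \<psi>\<close>. The function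
  \<open>F(t) = \<integral> u(x) \<psi>(x + t h) dx\<close> is smooth because \<open>\<psi>\<close> is, one has \<open>G(h) = F(1) - 2 F(0) + F(-1)\<close>, and
  two integrations by parts give
  \<open>F''(t) = \<Sum>\<^sub>k\<^sub>l h\<^sub>k h\<^sub>l \<integral> \<psi>(x + t h) d(D\<^sup>2u)\<^sub>k\<^sub>l\<close>. A signed measure of finite total variation is
  Lipschitz in the supremum norm, so this one formula yields two facts
  (\<open>weak_hessian.second_difference_estimate\<close>): \<open>\<bar>G(h)\<bar> \<le> K \<bar>h\<bar>\<^sup>2 sup \<bar>\<psi>\<bar>\<close>, and
  \<open>G(h) = \<Sum>\<^sub>k\<^sub>l h\<^sub>k h\<^sub>l (\<integral> \<psi> d(D\<^sup>2u)\<^sub>k\<^sub>l) + o(\<bar>h\<bar>\<^sup>2)\<close>.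

  By duality the first fact gives \<open>\<integral> \<bar>\<Delta>\<^sub>h u\<bar> \<le> K \<bar>h\<bar>\<^sup>2\<close> (\<open>weak_hessian.L1_second_difference\<close>). The kernel of
  the non-local Hessian is at most \<open>2 \<rho>(h) / \<bar>h\<bar>\<^sup>2\<close>, so Tonelli's theorem shows that the defining
  integrals converge for almost every \<open>x\<close> and that the functions \<open>H\<^sub>n u\<close> are bounded in \<open>L\<^sup>1\<close>
  uniformly in \<open>n\<close>.

  By Fubini's theorem, \<open>\<integral> (H\<^sub>n u)\<^sub>i\<^sub>j \<psi>\<close> is the integral of \<open>G\<close> against the kernel. Its quadratic part
  contributes exactly \<open>\<integral> \<psi> d(D\<^sup>2u)\<^sub>i\<^sub>j\<close>: a radial \<open>\<rho>\<close> has the fourth moments of the uniform distribution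
  on a sphere, namely
  \<open>(\<delta>\<^sub>k\<^sub>l \<delta>\<^sub>i\<^sub>j + \<delta>\<^sub>k\<^sub>i \<delta>\<^sub>l\<^sub>j + \<delta>\<^sub>k\<^sub>j \<delta>\<^sub>l\<^sub>i) / (N (N + 2))\<close> (\<open>fourth_moment_isotropic\<close>), and both the constant
  \<open>N (N + 2) / 2\<close> and the trace correction in the kernel are there to turn these into a projection
  onto the entry \<open>(i, j)\<close> (\<open>hessian_kernel_quadratic_form\<close>). The remainder tends to \<open>0\<close> because the mass
  of \<open>\<rho>\<^sub>n\<close> concentrates at the origin.

  The passage from test functions to \<open>C\<^sub>0\<close> uses the uniform \<open>L\<^sup>1\<close> bound and the density of
  test functions in the supremum norm (\<open>test_functions_dense_C0\<close>), which comes from multiplying a smooth bump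
  by Stone-Weierstrass polynomials.
\<close>

section \<open>Finite signed measures are bounded\<close>

lemma finite_radon_measure_empty:
  assumes "finite_radon_measure m"
  shows "m {} = 0"
proof -
  have "(\<lambda>i::nat. m {}) sums m (\<Union>i::nat. {})"
    using assms unfolding finite_radon_measure_def
    by (elim allE[of _ "\<lambda>_. {}"]) (auto simp: disjoint_family_on_def)
  then have "(\<lambda>i::nat. m {}) \<longlonglongrightarrow> 0"
    using sums_summable summable_LIMSEQ_zero by blast
  then show ?thesis by (simp add: LIMSEQ_const_iff)
qed

lemma finite_radon_measure_Un:
  assumes "finite_radon_measure m" "A \<in> sets borel" "B \<in> sets borel" "A \<inter> B = {}"
  shows "m (A \<union> B) = m A + m B"
proof -
  have "(\<lambda>i. m (binaryset A B i)) sums m (\<Union>i. binaryset A B i)"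
  proof -
    have "range (binaryset A B) \<subseteq> sets borel" "disjoint_family (binaryset A B)"
      using assms by (auto simp: binaryset_def disjoint_family_on_def)
    then show ?thesis using assms(1) unfolding finite_radon_measure_def by blast
  qed
  moreover have "(\<lambda>i. m (binaryset A B i)) sums (m A + m B)"
    by (rule binaryset_sums) (rule finite_radon_measure_empty[OF assms(1)])
  ultimately show ?thesis using sums_unique2 UN_binaryset_eq by metis
qed

text \<open>If the values were unbounded, then every set with unbounded values on its subsets would split into a
  set of the same kind and a remainder of measure at least \<open>1\<close> in absolute value: for \<open>A \<subseteq> E\<close> with
  \<open>\<bar>m A\<bar> > \<bar>m E\<bar> + 1\<close>, both \<open>A\<close> and \<open>E - A\<close> are large, and one of them still has unbounded values.
  Iterating produces disjoint remainders, and countable additivity makes the series of their measures converge although its terms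
  are at least \<open>1\<close> in absolute value.\<close>
lemma finite_radon_measure_bounded:
  fixes m :: "'a::euclidean_space set \<Rightarrow> real"
  assumes m: "finite_radon_measure m"
  shows "\<exists>C. \<forall>B\<in>sets borel. \<bar>m B\<bar> \<le> C"
proof (rule ccontr)
  \<comment> \<open>sets on whose Borel subsets the values are unbounded\<close>
  define bad where "bad E \<longleftrightarrow> E \<in> sets borel \<and> (\<forall>C. \<exists>B\<in>sets borel. B \<subseteq> E \<and> \<bar>m B\<bar> > C)" for E
  assume "\<not> ?thesis"
  then have bad_UNIV: "bad UNIV"
    by (auto simp: bad_def not_le)
  have split: "bad A \<or> bad (E - A)" if hE: "bad E" and hA: "A \<in> sets borel" "A \<subseteq> E" for A E
  proof (rule ccontr)
    assume "\<not> ?thesis"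
    moreover have E: "E \<in> sets borel" using hE bad_def by blast
    ultimately obtain C1 C2
      where C1: "\<And>B. B \<in> sets borel \<Longrightarrow> B \<subseteq> A \<Longrightarrow> \<bar>m B\<bar> \<le> C1"
        and C2: "\<And>B. B \<in> sets borel \<Longrightarrow> B \<subseteq> E - A \<Longrightarrow> \<bar>m B\<bar> \<le> C2"
      using hA(1) by (force simp: bad_def not_less)
    obtain B where B: "B \<in> sets borel" "B \<subseteq> E" "\<bar>m B\<bar> > C1 + C2"
      using hE bad_def by blast
    have "m B = m (B \<inter> A) + m (B - A)"
      using finite_radon_measure_Un[OF m, of "B \<inter> A" "B - A"] B(1) hA(1)
      by (metis Int_Diff_Un Int_Diff_disjoint sets.Diff sets.Int)
    moreover have "\<bar>m (B \<inter> A)\<bar> \<le> C1" "\<bar>m (B - A)\<bar> \<le> C2"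
      using B hA by (auto intro!: C1 C2)
    ultimately show False using B(3) by linarith
  qed
  have step: "\<exists>E'. bad E' \<and> E' \<subseteq> E \<and> \<bar>m (E - E')\<bar> \<ge> 1" if E: "bad E" for E
  proof -
    have Eb: "E \<in> sets borel" using E bad_def by blast
    obtain A where A: "A \<in> sets borel" "A \<subseteq> E" "\<bar>m A\<bar> > \<bar>m E\<bar> + 1"
      using E bad_def by blast
    have "m E = m A + m (E - A)"
      using finite_radon_measure_Un[OF m A(1), of "E - A"] A Eb
      by (metis Diff_disjoint Un_Diff_cancel sets.Diff sup.absorb_iff2)
    then have "\<bar>m (E - A)\<bar> \<ge> 1" using A(3) by linarith
    moreover have "E - (E - A) = A" using A(2) by blast
    moreover have "\<bar>m A\<bar> \<ge> 1" using A(3) by linarith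
    ultimately show ?thesis using split[OF E A(1,2)]
      by (metis A(2) Diff_subset)
  qed
  have "\<exists>S. \<forall>n. bad (S n) \<and> (S (Suc n) \<subseteq> S n \<and> \<bar>m (S n - S (Suc n))\<bar> \<ge> 1)"
    by (rule dependent_nat_choice) (use bad_UNIV step in blast)+
  then obtain S where S: "\<And>n. bad (S n)" "\<And>n. S (Suc n) \<subseteq> S n" "\<And>n::nat. \<bar>m (S n - S (Suc n))\<bar> \<ge> 1"
    by blast
  have anti: "S k \<subseteq> S n" if "n \<le> k" for n k
    using lift_Suc_antimono_le[of S, OF S(2) that] .
  have "disjoint_family (\<lambda>n. S n - S (Suc n))"
    unfolding disjoint_family_on_def
  proof (intro ballI impI)
    fix a b :: nat assume "a \<noteq> b"
    then consider "Suc a \<le> b" | "Suc b \<le> a" by linarith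
    then show "(S a - S (Suc a)) \<inter> (S b - S (Suc b)) = {}"
      using anti by cases blast+
  qed
  moreover have "range (\<lambda>n. S n - S (Suc n)) \<subseteq> sets borel"
    using S(1) bad_def by auto
  ultimately have "summable (\<lambda>n. m (S n - S (Suc n)))"
    using m unfolding finite_radon_measure_def by (meson sums_summable)
  then have "(\<lambda>n. m (S n - S (Suc n))) \<longlonglongrightarrow> 0" by (rule summable_LIMSEQ_zero)
  then obtain n where "\<bar>m (S n - S (Suc n))\<bar> < 1"
    using LIMSEQ_D[of _ 0 1] by force
  then show False using S(3)[of n] by simp
qed

text \<open>Boundedness of \<open>m\<close> bounds the supremum that defines the variation, and a measure built by
  \<^const>\<open>measure_of\<close> has either this value or \<open>0\<close> on the whole space. So finiteness, which is all that
  linearity and continuity of the signed integral rest on, is available without the Hahn decomposition.\<close>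
lemma positive_variation_finite:
  assumes m: "finite_radon_measure m"
  shows "finite_measure (positive_variation m)" "sets (positive_variation m) = sets borel"
    "space (positive_variation m) = UNIV"
proof -
  show sp: "space (positive_variation m) = UNIV"
    unfolding positive_variation_def by (rule space_measure_of) simp
  show st: "sets (positive_variation m) = sets borel"
    unfolding positive_variation_def
    by (subst sets_measure_of) (auto simp: sets.sigma_sets_eq[of borel, simplified])
  obtain C where C: "\<And>B. B \<in> sets borel \<Longrightarrow> \<bar>m B\<bar> \<le> C"
    using finite_radon_measure_bounded[OF m] by blast
  have "(SUP B\<in>{B \<in> sets borel. B \<subseteq> (UNIV::'a set)}. ennreal (m B)) \<le> ennreal C"
    using C by (intro SUP_least ennreal_leI) (auto dest: abs_le_D1)
  then have "emeasure (positive_variation m) UNIV \<le> ennreal C"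
    unfolding positive_variation_def by (simp add: emeasure_measure_of_conv)
  then show "finite_measure (positive_variation m)"
    by (intro finite_measureI) (auto simp: sp top_unique)
qed

lemma finite_radon_measure_uminus:
  "finite_radon_measure m \<Longrightarrow> finite_radon_measure (\<lambda>A. - m A)"
  unfolding finite_radon_measure_def by (auto intro: sums_minus)

text \<open>The total mass of the two variations serves as the constant. The estimate is phrased for differences, so that
  it can be applied to two test functions as well as to a test function and a \<open>C\<^sub>0\<close> function.\<close>
lemma signed_integral_lipschitz:
  assumes m: "finite_radon_measure m"
  shows "\<exists>C\<ge>0. \<forall>f g e. f \<in> borel_measurable borel \<longrightarrow> g \<in> borel_measurable borel \<longrightarrow>
     bounded (range f) \<longrightarrow> bounded (range g) \<longrightarrow> (\<forall>x. \<bar>f x - g x\<bar> \<le> e) \<longrightarrow>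
     \<bar>signed_integral m f - signed_integral m g\<bar> \<le> C * e"
proof -
  have *: "\<bar>integral\<^sup>L M f - integral\<^sup>L M g\<bar> \<le> measure M UNIV * e"
    if M: "finite_measure M" "sets M = sets borel" "space M = (UNIV::'a set)"
      and f: "f \<in> borel_measurable borel" "bounded (range f)"
      and g: "g \<in> borel_measurable borel" "bounded (range g)"
      and e: "\<And>x. \<bar>f x - g x\<bar> \<le> e" for M and f g :: "'a \<Rightarrow> real" and e
  proof -
    interpret finite_measure M by fact
    have int: "integrable M k" if k: "k \<in> borel_measurable borel" "bounded (range k)" for k :: "'a \<Rightarrow> real"
    proof -
      obtain B where "\<And>x. norm (k x) \<le> B" using k(2) by (auto simp: bounded_iff)
      moreover have "k \<in> borel_measurable M" using k(1) by (subst measurable_cong_sets[OF M(2) refl])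
      ultimately show ?thesis by (intro integrable_const_bound[of _ B]) auto
    qed
    have int_fg: "integrable M f" "integrable M g" using int f g by blast+
    have "\<bar>integral\<^sup>L M f - integral\<^sup>L M g\<bar> = \<bar>\<integral>x. f x - g x \<partial>M\<bar>"
      by (simp only: Bochner_Integration.integral_diff[OF int_fg])
    also have "\<dots> \<le> (\<integral>x. \<bar>f x - g x\<bar> \<partial>M)" by (rule integral_abs_bound)
    also have "\<dots> \<le> (\<integral>x. e \<partial>M)"
      using int_fg e by (intro integral_mono) auto
    finally show ?thesis using M(3) by simp
  qed
  let ?P = "positive_variation m" and ?N = "positive_variation (\<lambda>A. - m A)"
  show ?thesis
  proof (intro exI conjI allI impI)
    show "0 \<le> measure ?P UNIV + measure ?N UNIV" by simp
    fix f g :: "'a \<Rightarrow> real" and e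
    assume fg: "f \<in> borel_measurable borel" "g \<in> borel_measurable borel"
     "bounded (range f)" "bounded (range g)" "\<forall>x. \<bar>f x - g x\<bar> \<le> e"
    have "\<bar>integral\<^sup>L ?P f - integral\<^sup>L ?P g\<bar> \<le> measure ?P UNIV * e"
      using fg by (intro * positive_variation_finite m) auto
    moreover have "\<bar>integral\<^sup>L ?N f - integral\<^sup>L ?N g\<bar> \<le> measure ?N UNIV * e"
      using fg by (intro * positive_variation_finite finite_radon_measure_uminus m) auto
    ultimately show "\<bar>signed_integral m f - signed_integral m g\<bar> \<le> (measure ?P UNIV + measure ?N UNIV) * e"
      unfolding signed_integral_def distrib_right by linarith
  qed
qed

section \<open>Calculus of test functions\<close>

lemma partial_deriv_eq:
  assumes "(f has_derivative F) (at x)"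
  shows "partial_deriv i f x = F (axis i 1)"
  unfolding partial_deriv_def using frechet_derivative_at[OF assms] by simp

lemma has_derivative_partial_deriv:
  assumes "f differentiable (at x)"
  shows "(f has_derivative (\<lambda>v. \<Sum>i\<in>UNIV. v $ i * partial_deriv i f x)) (at x)"
proof -
  have D: "(f has_derivative frechet_derivative f (at x)) (at x)"
    using assms frechet_derivative_works by blast
  have "frechet_derivative f (at x) v = (\<Sum>i\<in>UNIV. v $ i * partial_deriv i f x)" for v
  proof -
    have lin: "linear (frechet_derivative f (at x))"
      using D has_derivative_linear by blast
    have "frechet_derivative f (at x) v = frechet_derivative f (at x) (\<Sum>i\<in>UNIV. v $ i *\<^sub>R axis i 1)"
      using basis_expansion[of v] by (simp add: scalar_mult_eq_scaleR)
    also have "\<dots> = (\<Sum>i\<in>UNIV. v $ i * partial_deriv i f x)"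
      using lin by (simp add: linear_sum linear_scale partial_deriv_def)
    finally show ?thesis .
  qed
  then have "frechet_derivative f (at x) = (\<lambda>v. \<Sum>i\<in>UNIV. v $ i * partial_deriv i f x)" by blast
  with D show ?thesis by simp
qed

lemma test_function_differentiable:
  assumes "\<psi> \<in> test_functions"
  shows "\<psi> differentiable (at x)"
proof -
  have "C_k (Suc 0) \<psi>" using assms unfolding test_functions_def by blast
  then show ?thesis by (simp add: differentiable_on_def)
qed

lemmas test_function_has_derivative =
  has_derivative_partial_deriv[OF test_function_differentiable]

lemma test_function_continuous:
  assumes "\<psi> \<in> test_functions"
  shows "continuous_on UNIV \<psi>"
proof -
  have "C_k 0 \<psi>" using assms unfolding test_functions_def by blast
  then show ?thesis by simp
qed

lemma test_function_borel: "\<psi> \<in> test_functions \<Longrightarrow> \<psi> \<in> borel_measurable borel"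
  by (intro borel_measurable_continuous_onI test_function_continuous)

lemma test_function_partial_deriv:
  assumes \<psi>: "\<psi> \<in> test_functions"
  shows "partial_deriv i \<psi> \<in> test_functions"
proof -
  have "C_k k (partial_deriv i \<psi>)" for k
  proof -
    have "C_k (Suc k) \<psi>" using \<psi> unfolding test_functions_def by blast
    then show ?thesis by simp
  qed
  moreover have "compact (closure {x. partial_deriv i \<psi> x \<noteq> 0})"
  proof -
    let ?K = "closure {x. \<psi> x \<noteq> 0}"
    have "partial_deriv i \<psi> x = 0" if "x \<notin> ?K" for x
    proof -
      have "(\<psi> has_derivative (\<lambda>_. 0)) (at x)"
      proof (rule has_derivative_transform_within_open)
        show "((\<lambda>_. 0) has_derivative (\<lambda>_. 0)) (at x)" by simp
        show "open (- ?K)" by (intro open_Compl closed_closure)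
        show "x \<in> - ?K" using that by simp
        show "\<And>y. y \<in> - ?K \<Longrightarrow> 0 = \<psi> y"
          by (metis (mono_tags, lifting) ComplD closure_subset mem_Collect_eq subsetD)
      qed
      then show ?thesis using partial_deriv_eq by metis
    qed
    then have "closure {x. partial_deriv i \<psi> x \<noteq> 0} \<subseteq> ?K"
      by (intro closure_minimal) auto
    moreover have "compact ?K" using \<psi> unfolding test_functions_def by blast
    ultimately show ?thesis
      using compact_Int_closed[of ?K "closure {x. partial_deriv i \<psi> x \<noteq> 0}"]
      by (simp only: closed_closure Int_absorb1 simp_thms)
  qed
  ultimately show ?thesis unfolding test_functions_def by blast
qed

lemma differentiable_translate:
  fixes f :: "real^'n::finite \<Rightarrow> real"
  assumes "f differentiable (at (x + a))"
  shows "(\<lambda>x. f (x + a)) differentiable (at x)"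
    and "partial_deriv i (\<lambda>x. f (x + a)) x = partial_deriv i f (x + a)"
proof -
  have "((\<lambda>x. f (x + a)) has_derivative (\<lambda>v. \<Sum>i\<in>UNIV. v $ i * partial_deriv i f (x + a))) (at x)"
  proof -
    have "((\<lambda>x. x + a) has_derivative (\<lambda>v. v)) (at x)"
      by (auto intro!: derivative_eq_intros)
    from has_derivative_compose[OF this has_derivative_partial_deriv[OF assms]]
    show ?thesis by simp
  qed
  note D = this
  show "(\<lambda>x. f (x + a)) differentiable (at x)" using D differentiable_def by blast
  show "partial_deriv i (\<lambda>x. f (x + a)) x = partial_deriv i f (x + a)"
    using partial_deriv_eq[OF D] by (simp add: axis_def if_distrib[of "\<lambda>t. t * _"] cong: if_cong)
qed

lemma C_k_translate: "C_k k f \<Longrightarrow> C_k k (\<lambda>x. f (x + a))"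
proof (induction k arbitrary: f)
  case 0
  then show ?case
    by (auto intro!: continuous_on_compose2[of UNIV f] continuous_intros)
next
  case (Suc k)
  then have d: "f differentiable (at x)" for x by (simp add: differentiable_on_def)
  have "partial_deriv i (\<lambda>x. f (x + a)) = (\<lambda>x. partial_deriv i f (x + a))" for i
    using differentiable_translate(2)[OF d] by blast
  then show ?case
    using Suc differentiable_translate(1)[OF d] by (simp add: differentiable_on_def)
qed

lemma test_function_translate:
  assumes \<psi>: "\<psi> \<in> test_functions"
  shows "(\<lambda>x. \<psi> (x + a)) \<in> test_functions"
proof -
  have "closure {x. \<psi> (x + a) \<noteq> 0} = (+) (-a) ` closure {x. \<psi> x \<noteq> 0}"
  proof -
    have "{x. \<psi> (x + a) \<noteq> 0} = (+) (-a) ` {x. \<psi> x \<noteq> 0}"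
      by (force simp: image_iff algebra_simps)
    then show ?thesis by (simp only: closure_translation)
  qed
  moreover have "compact (closure {x. \<psi> x \<noteq> 0})"
    using \<psi> unfolding test_functions_def by blast
  ultimately have "compact (closure {x. \<psi> (x + a) \<noteq> 0})"
    using compact_translation by metis
  then show ?thesis
    using \<psi> C_k_translate unfolding test_functions_def by blast
qed

lemma test_function_bounded:
  assumes \<psi>: "\<psi> \<in> test_functions"
  obtains K where "K \<ge> 0" "\<And>x. \<bar>\<psi> x\<bar> \<le> K"
proof -
  let ?K = "closure {x. \<psi> x \<noteq> 0}"
  have "compact (\<psi> ` ?K)"
    using \<psi> continuous_on_subset[OF test_function_continuous[OF \<psi>]] unfolding test_functions_def
    by (intro compact_continuous_image) blast+
  then obtain B where B: "\<And>x. x \<in> ?K \<Longrightarrow> \<bar>\<psi> x\<bar> \<le> B"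
    using compact_imp_bounded bounded_iff[of "\<psi> ` ?K"] by auto
  have "\<bar>\<psi> x\<bar> \<le> max B 0" for x
  proof (cases "\<psi> x = 0")
    case False
    then have "x \<in> ?K" using closure_subset by fastforce
    then show ?thesis using B[of x] by linarith
  qed auto
  then show ?thesis using that[of "max B 0"] by auto
qed

lemma test_function_lipschitz:
  assumes \<psi>: "\<psi> \<in> test_functions"
  obtains L where "L \<ge> 0" "\<And>x y. \<bar>\<psi> x - \<psi> y\<bar> \<le> L * norm (x - y)"
proof -
  have "\<forall>i. \<exists>K\<ge>0. \<forall>x. \<bar>partial_deriv i \<psi> x\<bar> \<le> K"
    using test_function_bounded[OF test_function_partial_deriv[OF \<psi>]] by metis
  then obtain K where K: "\<And>i. K i \<ge> 0" "\<And>i x. \<bar>partial_deriv i \<psi> x\<bar> \<le> K i" by metis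
  have "norm (\<psi> x - \<psi> y) \<le> (\<Sum>i\<in>UNIV. K i) * norm (x - y)" for x y
  proof (rule differentiable_bound)
    show "convex (UNIV :: (real^'a) set)" by simp
    show "(\<psi> has_derivative (\<lambda>v. \<Sum>i\<in>UNIV. v $ i * partial_deriv i \<psi> x)) (at x within UNIV)" for x
      using test_function_has_derivative[OF \<psi>] by simp
    show "onorm (\<lambda>v. \<Sum>i\<in>UNIV. v $ i * partial_deriv i \<psi> x) \<le> (\<Sum>i\<in>UNIV. K i)" for x
    proof (rule onorm_bound)
      fix v :: "real^'a"
      have "norm (\<Sum>i\<in>UNIV. v $ i * partial_deriv i \<psi> x) \<le> (\<Sum>i\<in>UNIV. norm v * K i)"
        using K component_le_norm_cart[of v]
        by (intro sum_norm_le) (auto simp: abs_mult intro!: mult_mono)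
      then show "norm (\<Sum>i\<in>UNIV. v $ i * partial_deriv i \<psi> x) \<le> (\<Sum>i\<in>UNIV. K i) * norm v"
        by (simp add: sum_distrib_left sum_distrib_right mult.commute)
    qed (simp add: K sum_nonneg)
  qed auto
  then show ?thesis using that[of "\<Sum>i\<in>UNIV. K i"] K by (auto simp: sum_nonneg)
qed

lemma test_function_line_derivative:
  assumes \<psi>: "\<psi> \<in> test_functions"
  shows "((\<lambda>t. \<psi> (x + t *\<^sub>R h)) has_real_derivative
           (\<Sum>i\<in>UNIV. h $ i * partial_deriv i \<psi> (x + t *\<^sub>R h))) (at t)"
proof -
  have line: "((\<lambda>t. x + t *\<^sub>R h) has_derivative (\<lambda>s. s *\<^sub>R h)) (at t)"
    using has_derivative_add[OF has_derivative_const has_derivative_scaleR_left[OF has_derivative_ident]]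
    by simp
  have "(\<Sum>i\<in>UNIV. (s *\<^sub>R h) $ i * partial_deriv i \<psi> z) = (\<Sum>i\<in>UNIV. h $ i * partial_deriv i \<psi> z) * s" for s z
    unfolding sum_distrib_right by (rule sum.cong) simp_all
  with has_derivative_compose[OF line test_function_has_derivative[OF \<psi>]]
  show ?thesis unfolding has_field_derivative_def by simp
qed

text \<open>Clairaut's theorem: applying the mean value theorem twice, in either order, to the mixed second difference of
  \<open>\<psi>\<close> over a square of side \<open>s\<close> expresses it as \<open>s\<^sup>2\<close> times either mixed partial derivative at some point of the square.
  Both derivatives are Lipschitz, so letting \<open>s\<close> tend to \<open>0\<close> identifies them.\<close>
lemma test_function_mixed_partials_commute:
  fixes \<psi> :: "real^'n::finite \<Rightarrow> real"
  assumes \<psi>: "\<psi> \<in> test_functions"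
  shows "partial_deriv i (partial_deriv j \<psi>) x = partial_deriv j (partial_deriv i \<psi>) x"
proof -
  have line: "((\<lambda>t. f (z + t *\<^sub>R axis k 1)) has_real_derivative partial_deriv k f (z + t *\<^sub>R axis k 1)) (at t)"
    if "f \<in> test_functions" for f :: "real^'n \<Rightarrow> real" and z k t
    using test_function_line_derivative[OF that, of z "axis k 1" t]
    by (simp add: axis_def if_distrib[of "\<lambda>t. t * _"] cong: if_cong)
  have mvt: "\<exists>s1 s2. 0 < s1 \<and> s1 < s \<and> 0 < s2 \<and> s2 < s \<and>
      \<psi> (x + s *\<^sub>R axis k 1 + s *\<^sub>R axis l 1) - \<psi> (x + s *\<^sub>R axis k 1) - \<psi> (x + s *\<^sub>R axis l 1) + \<psi> x
       = s\<^sup>2 * partial_deriv l (partial_deriv k \<psi>) (x + s1 *\<^sub>R axis k 1 + s2 *\<^sub>R axis l 1)"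
    if "s > 0" for s k l
  proof -
    have "((\<lambda>t. \<psi> ((x + s *\<^sub>R axis l 1) + t *\<^sub>R axis k 1) - \<psi> (x + t *\<^sub>R axis k 1)) has_real_derivative
        (partial_deriv k \<psi> ((x + s *\<^sub>R axis l 1) + t *\<^sub>R axis k 1) - partial_deriv k \<psi> (x + t *\<^sub>R axis k 1))) (at t)" for t
      by (intro DERIV_diff line \<psi>)
      \<comment> \<open>first along direction \<open>k\<close>, then along direction \<open>l\<close>\<close>
  from MVT2[OF that this] obtain s1 where s1: "0 < s1" "s1 < s"
      "\<psi> ((x + s *\<^sub>R axis l 1) + s *\<^sub>R axis k 1) - \<psi> (x + s *\<^sub>R axis k 1) - (\<psi> (x + s *\<^sub>R axis l 1) - \<psi> x)
       = s * (partial_deriv k \<psi> ((x + s *\<^sub>R axis l 1) + s1 *\<^sub>R axis k 1) - partial_deriv k \<psi> (x + s1 *\<^sub>R axis k 1))"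
      by auto
    from MVT2[OF that line[OF test_function_partial_deriv[OF \<psi>], of k "x + s1 *\<^sub>R axis k 1" l]]
    obtain s2 where s2: "0 < s2" "s2 < s"
      "partial_deriv k \<psi> (x + s1 *\<^sub>R axis k 1 + s *\<^sub>R axis l 1) - partial_deriv k \<psi> (x + s1 *\<^sub>R axis k 1)
        = s * partial_deriv l (partial_deriv k \<psi>) (x + s1 *\<^sub>R axis k 1 + s2 *\<^sub>R axis l 1)"
      by auto
    show ?thesis
      using s1 s2 by (intro exI[of _ s1] exI[of _ s2]) (simp add: power2_eq_square algebra_simps)
  qed
  obtain L where L: "\<And>x y. \<bar>partial_deriv i (partial_deriv j \<psi>) x - partial_deriv i (partial_deriv j \<psi>) y\<bar> \<le> L * norm (x - y)"
    using test_function_lipschitz[OF test_function_partial_deriv[OF test_function_partial_deriv[OF \<psi>]]] by metis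
  obtain M where M: "\<And>x y. \<bar>partial_deriv j (partial_deriv i \<psi>) x - partial_deriv j (partial_deriv i \<psi>) y\<bar> \<le> M * norm (x - y)"
    using test_function_lipschitz[OF test_function_partial_deriv[OF test_function_partial_deriv[OF \<psi>]]] by metis
  let ?d = "\<bar>partial_deriv i (partial_deriv j \<psi>) x - partial_deriv j (partial_deriv i \<psi>) x\<bar>"
  have "?d \<le> (2 * \<bar>L\<bar> + 2 * \<bar>M\<bar>) * s" if s: "s > 0" for s
  proof -
    have small: "norm (x - (x + a *\<^sub>R axis k 1 + b *\<^sub>R axis l 1)) \<le> 2 * s"
      if "0 < a" "a < s" "0 < b" "b < s" for a b and k l :: 'n
    proof -
      have "norm (x - (x + a *\<^sub>R axis k 1 + b *\<^sub>R axis l 1)) = norm (a *\<^sub>R axis k 1 + b *\<^sub>R (axis l 1 :: real^'n))"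
        by (metis add.assoc add_diff_cancel_left' norm_minus_commute)
      also have "\<dots> \<le> a + b"
        using that by (intro order_trans[OF norm_triangle_ineq]) (simp add: norm_axis_1)
      finally show ?thesis using that by linarith
    qed
    obtain a b where ab: "0 < a" "a < s" "0 < b" "b < s"
      "\<psi> (x + s *\<^sub>R axis j 1 + s *\<^sub>R axis i 1) - \<psi> (x + s *\<^sub>R axis j 1) - \<psi> (x + s *\<^sub>R axis i 1) + \<psi> x
       = s\<^sup>2 * partial_deriv i (partial_deriv j \<psi>) (x + a *\<^sub>R axis j 1 + b *\<^sub>R axis i 1)"
      using mvt[OF s, of j i] by blast
    obtain c d where cd: "0 < c" "c < s" "0 < d" "d < s"
      "\<psi> (x + s *\<^sub>R axis i 1 + s *\<^sub>R axis j 1) - \<psi> (x + s *\<^sub>R axis i 1) - \<psi> (x + s *\<^sub>R axis j 1) + \<psi> x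
       = s\<^sup>2 * partial_deriv j (partial_deriv i \<psi>) (x + c *\<^sub>R axis i 1 + d *\<^sub>R axis j 1)"
      using mvt[OF s, of i j] by blast
    have "s\<^sup>2 * partial_deriv i (partial_deriv j \<psi>) (x + a *\<^sub>R axis j 1 + b *\<^sub>R axis i 1)
       = s\<^sup>2 * partial_deriv j (partial_deriv i \<psi>) (x + c *\<^sub>R axis i 1 + d *\<^sub>R axis j 1)"
      using ab(5) cd(5) by (simp add: algebra_simps)
    then have eq: "partial_deriv i (partial_deriv j \<psi>) (x + a *\<^sub>R axis j 1 + b *\<^sub>R axis i 1)
       = partial_deriv j (partial_deriv i \<psi>) (x + c *\<^sub>R axis i 1 + d *\<^sub>R axis j 1)"
      using s by simp
    have 1: "\<bar>partial_deriv i (partial_deriv j \<psi>) x - partial_deriv i (partial_deriv j \<psi>) (x + a *\<^sub>R axis j 1 + b *\<^sub>R axis i 1)\<bar>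
        \<le> \<bar>L\<bar> * (2 * s)"
      by (rule order_trans[OF L]) (intro mult_mono small ab, auto)
    have 2: "\<bar>partial_deriv j (partial_deriv i \<psi>) x - partial_deriv j (partial_deriv i \<psi>) (x + c *\<^sub>R axis i 1 + d *\<^sub>R axis j 1)\<bar>
        \<le> \<bar>M\<bar> * (2 * s)"
      by (rule order_trans[OF M]) (intro mult_mono small cd, auto)
    show ?thesis using 1 2 eq by (simp add: algebra_simps)
  qed
  note bound = this
  have "?d \<le> 0"
  proof (rule field_le_epsilon)
    fix e :: real assume "e > 0"
    define B where "B = 2 * \<bar>L\<bar> + 2 * \<bar>M\<bar> + 1"
    have "B > 0" unfolding B_def by linarith
    then have "?d \<le> (B - 1) * (e / B)"
      using bound[of "e / B"] \<open>e > 0\<close> by (simp add: B_def)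
    also have "\<dots> \<le> B * (e / B)"
      using \<open>e > 0\<close> \<open>B > 0\<close> by (intro mult_right_mono) auto
    finally show "?d \<le> 0 + e" using \<open>B > 0\<close> by simp
  qed
  then show ?thesis by simp
qed

section \<open>Test functions are dense and determine the L1 norm\<close>

lemma C_k_add: "C_k k f \<Longrightarrow> C_k k g \<Longrightarrow> C_k k (\<lambda>x. f x + g x)"
proof (induction k arbitrary: f g)
  case 0
  then show ?case by (auto intro: continuous_intros)
next
  case (Suc k)
  then have d: "f differentiable (at x)" "g differentiable (at x)" for x
    by (simp_all add: differentiable_on_def)
  have "partial_deriv i (\<lambda>x. f x + g x) = (\<lambda>x. partial_deriv i f x + partial_deriv i g x)" for i
  proof
    fix x
    have "((\<lambda>x. f x + g x) has_derivative (\<lambda>v. frechet_derivative f (at x) v + frechet_derivative g (at x) v)) (at x)"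
      using d frechet_derivative_works by (intro has_derivative_add) blast+
    then show "partial_deriv i (\<lambda>x. f x + g x) x = partial_deriv i f x + partial_deriv i g x"
      using partial_deriv_eq unfolding partial_deriv_def by blast
  qed
  then show ?case using Suc d by (simp add: differentiable_on_def)
qed

text \<open>Polynomials are closed under differentiation, which makes the induction for the smoothness of
  polynomial multiples of a bump function go through.\<close>
lemma real_polynomial_function_partial_deriv:
  fixes p :: "real^'n::finite \<Rightarrow> real"
  assumes "real_polynomial_function p"
  shows "(\<forall>x. p differentiable (at x)) \<and> (\<forall>i. real_polynomial_function (partial_deriv i p))"
  using assms
proof induction
  case (linear f)
  then have D: "(f has_derivative f) (at x)" for x
    by (rule bounded_linear_imp_has_derivative)
  then have "partial_deriv i f = (\<lambda>x. f (axis i 1))" for i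
    using partial_deriv_eq by blast
  then show ?case using differentiableI[OF D] by auto
next
  case (const c)
  have "partial_deriv i (\<lambda>x::real^'n. c) = (\<lambda>x. 0)" for i
    using partial_deriv_eq[OF has_derivative_const] by blast
  then show ?case by auto
next
  case (add f g)
  then have D: "((\<lambda>x. f x + g x) has_derivative (\<lambda>v. frechet_derivative f (at x) v + frechet_derivative g (at x) v)) (at x)" for x
    using frechet_derivative_works by (intro has_derivative_add) blast+
  then have "partial_deriv i (\<lambda>x. f x + g x) = (\<lambda>x. partial_deriv i f x + partial_deriv i g x)" for i
    using partial_deriv_eq[OF D] unfolding partial_deriv_def by blast
  then show ?case using add differentiableI[OF D] by auto
next
  case (mult f g)
  then have D: "((\<lambda>x. f x * g x) has_derivative (\<lambda>v. f x * frechet_derivative g (at x) v + frechet_derivative f (at x) v * g x)) (at x)" for x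
    using frechet_derivative_works by (intro has_derivative_mult) blast+
  then have "partial_deriv i (\<lambda>x. f x * g x) = (\<lambda>x. f x * partial_deriv i g x + partial_deriv i f x * g x)" for i
    using partial_deriv_eq[OF D] unfolding partial_deriv_def by blast
  moreover have "real_polynomial_function (\<lambda>x. f x * partial_deriv i g x + partial_deriv i f x * g x)" for i
    by (intro real_polynomial_function.intros(3) real_polynomial_function.intros(4)) (use mult in auto)
  ultimately show ?case using differentiableI[OF D] by simp
qed

definition flat_exp :: "nat \<Rightarrow> real \<Rightarrow> real" where
  "flat_exp m t = (if t > 0 then exp (- 1 / t) / t ^ m else 0)"

text \<open>The functions \<open>t\<^sup>-\<^sup>m exp (-1/t)\<close>, extended by \<open>0\<close>, differentiate into combinations of each other, even at
  \<open>t = 0\<close>, where the exponential beats every power.\<close>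
lemma flat_exp_derivative:
  "(flat_exp m has_real_derivative flat_exp (m + 2) t - real m * flat_exp (m + 1) t) (at t)"
proof -
  consider "t > 0" | "t < 0" | "t = 0" by linarith
  then show ?thesis
  proof cases
    case 1
    have "((\<lambda>t. exp (- 1 / t) / t ^ m) has_real_derivative
        flat_exp (m + 2) t - real m * flat_exp (m + 1) t) (at t)"
    proof -
      have "((\<lambda>t. exp (- 1 / t) / t ^ m) has_real_derivative
          (exp (- 1 / t) * (1 / t\<^sup>2) * t ^ m - exp (- 1 / t) * (real m * t ^ (m - 1))) / (t ^ m * t ^ m)) (at t)"
        using 1 by (auto intro!: derivative_eq_intros simp: power2_eq_square)
      moreover have "(exp (- 1 / t) * (1 / t\<^sup>2) * t ^ m - exp (- 1 / t) * (real m * t ^ (m - 1))) / (t ^ m * t ^ m)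
          = flat_exp (m + 2) t - real m * flat_exp (m + 1) t"
        using 1 by (cases m) (auto simp: flat_exp_def field_simps power2_eq_square)
      ultimately show ?thesis by simp
    qed
    moreover have "\<forall>\<^sub>F s in nhds t. exp (- 1 / s) / s ^ m = flat_exp m s"
      using eventually_nhds_in_open[of "{0<..}" t] 1
      by (auto simp: flat_exp_def elim!: eventually_mono)
    ultimately show ?thesis by (subst DERIV_cong_ev[OF refl _ refl, symmetric])
  next
    case 2
    have "\<forall>\<^sub>F s in nhds t. 0 = flat_exp m s"
      using eventually_nhds_in_open[of "{..<0}" t] 2
      by (auto simp: flat_exp_def elim!: eventually_mono)
    moreover have "((\<lambda>s. 0) has_real_derivative flat_exp (m + 2) t - real m * flat_exp (m + 1) t) (at t)"
      using 2 by (simp add: flat_exp_def)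
    ultimately show ?thesis by (subst DERIV_cong_ev[OF refl _ refl, symmetric])
  next
    case 3
    have "((\<lambda>s. flat_exp m s / s) \<longlongrightarrow> 0) (at_right 0)"
    proof -
      have "\<forall>\<^sub>F x in at_top. x ^ (m + 1) / exp x = flat_exp m (inverse x) / inverse x"
        using eventually_gt_at_top[of 0]
        by eventually_elim (simp add: flat_exp_def exp_minus field_simps)
      then show ?thesis
        unfolding filterlim_at_right_to_top
        using tendsto_power_div_exp_0[of "m + 1"] tendsto_cong by fast
    qed
    moreover have "((\<lambda>s. flat_exp m s / s) \<longlongrightarrow> 0) (at_left 0)"
    proof -
      have "\<forall>\<^sub>F s in at_left 0. 0 = flat_exp m s / s"
        by (auto simp: flat_exp_def eventually_at_left_field intro!: exI[of _ "-1"])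
      then show ?thesis using tendsto_cong tendsto_const by fast
    qed
    ultimately have "((\<lambda>s. flat_exp m s / s) \<longlongrightarrow> 0) (at 0)"
      by (rule filterlim_split_at[rotated])
    then show ?thesis using 3
      unfolding has_field_derivative_iff by (simp add: flat_exp_def)
  qed
qed

text \<open>The family of these functions is closed under partial derivatives up to sums: differentiating the polynomial
  keeps \<open>m\<close>, and differentiating the bump raises \<open>m\<close> and multiplies the polynomial by a linear one. Hence induction on \<open>k\<close>
  with \<open>p\<close> and \<open>m\<close> arbitrary.\<close>
lemma C_k_bump_polynomial:
  fixes p :: "real^'n::finite \<Rightarrow> real"
  assumes "real_polynomial_function p"
  shows "C_k k (\<lambda>x. p x * flat_exp m (c - x \<bullet> x))"
  using assms
proof (induction k arbitrary: p m)
  have D: "((\<lambda>x. p x * flat_exp m (c - x \<bullet> x)) has_derivative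
      (\<lambda>v. p x * ((- 2 * (x \<bullet> v)) * (flat_exp (m + 2) (c - x \<bullet> x) - real m * flat_exp (m + 1) (c - x \<bullet> x)))
        + frechet_derivative p (at x) v * flat_exp m (c - x \<bullet> x))) (at x)"
    if p: "real_polynomial_function p" for p :: "real^'n \<Rightarrow> real" and m x
  proof (rule has_derivative_mult)
    show "(p has_derivative frechet_derivative p (at x)) (at x)"
      using real_polynomial_function_partial_deriv[OF p] frechet_derivative_works by blast
    have "((\<lambda>x. c - x \<bullet> x) has_derivative (\<lambda>v. - 2 * (x \<bullet> v))) (at x)"
      by (auto intro!: derivative_eq_intros simp: inner_commute)
    from has_derivative_compose[OF this flat_exp_derivative[unfolded has_field_derivative_def]]
    show "((\<lambda>x. flat_exp m (c - x \<bullet> x)) has_derivative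
       (\<lambda>v. (- 2 * (x \<bullet> v)) * (flat_exp (m + 2) (c - x \<bullet> x) - real m * flat_exp (m + 1) (c - x \<bullet> x)))) (at x)"
      by (simp add: mult.commute)
  qed
  {
    case 0
    show ?case using D[OF 0] has_derivative_continuous
      by (force simp: continuous_on_eq_continuous_at)
  next
    case (Suc k)
    have "partial_deriv i (\<lambda>x. p x * flat_exp m (c - x \<bullet> x)) =
        (\<lambda>x. partial_deriv i p x * flat_exp m (c - x \<bullet> x)
           + (((- 2) * (x $ i * p x)) * flat_exp (m + 2) (c - x \<bullet> x)
           + ((2 * real m) * (x $ i * p x)) * flat_exp (m + 1) (c - x \<bullet> x)))" for i
      using partial_deriv_eq[OF D[OF Suc.prems]]
      by (auto simp: partial_deriv_def inner_axis algebra_simps)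
    moreover have "real_polynomial_function (partial_deriv i p)" for i
      using real_polynomial_function_partial_deriv[OF Suc.prems] by blast
    moreover have "real_polynomial_function (\<lambda>x. a * (x $ i * p x))" for a i
      by (intro real_polynomial_function.intros(4)[OF real_polynomial_function.intros(2)]
          real_polynomial_function.intros(4)[OF real_polynomial_function.intros(1)[OF bounded_linear_vec_nth]]
          Suc.prems)
    ultimately have "C_k k (partial_deriv i (\<lambda>x. p x * flat_exp m (c - x \<bullet> x)))" for i
      by (simp only:) (intro C_k_add Suc.IH)
    moreover have "(\<lambda>x. p x * flat_exp m (c - x \<bullet> x)) differentiable (at x)" for x
      by (rule differentiableI[OF D[OF Suc.prems]])
    ultimately show ?case by (simp add: differentiable_on_def)
  }
qed

text \<open>Divide \<open>f\<close> by a smooth bump \<open>\<beta>\<close> that is positive on a ball larger than the support of \<open>f\<close>, approximate the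
  continuous quotient by a polynomial on the closed ball, and multiply back; since \<open>0 \<le> \<beta> \<le> 1\<close>, the error does not grow, and outside the
  ball both functions vanish.\<close>
lemma test_functions_dense_compact_support:
  fixes f :: "real^'n::finite \<Rightarrow> real"
  assumes f: "continuous_on UNIV f" and supp: "\<And>x. norm x > R \<Longrightarrow> f x = 0" and e: "e > 0"
  obtains \<psi> where "\<psi> \<in> test_functions" "\<And>x. \<bar>\<psi> x - f x\<bar> \<le> e"
proof -
  define S where "S = \<bar>R\<bar> + 1"
  define \<beta> :: "real^'n \<Rightarrow> real" where "\<beta> x = flat_exp 0 (S\<^sup>2 - x \<bullet> x)" for x
  have S: "S > 0" "S > R" unfolding S_def by auto
  have ball_iff: "S\<^sup>2 - x \<bullet> x > 0 \<longleftrightarrow> norm x < S" for x :: "real^'n"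
    using S(1) by (metis diff_gt_0_iff_gt norm_ge_zero order_less_imp_le power2_less_imp_less power2_norm_eq_inner power_strict_mono zero_less_numeral)
  have \<beta>_pos: "\<beta> x > 0" if "norm x < S" for x
    using that ball_iff by (simp add: \<beta>_def flat_exp_def)
  have \<beta>_le: "0 \<le> \<beta> x" "\<beta> x \<le> 1" for x by (auto simp: \<beta>_def flat_exp_def)
  have \<beta>_0: "\<beta> x = 0" if "\<not> norm x < S" for x
    using that ball_iff by (simp add: \<beta>_def flat_exp_def)
  have poly1: "real_polynomial_function (\<lambda>x::real^'n. 1)" by blast
  have \<beta>_cont: "continuous_on A \<beta>" for A
    using C_k_bump_polynomial[OF poly1, of 0 0 "S\<^sup>2"] continuous_on_subset[of UNIV \<beta> A]
    by (simp add: \<beta>_def[abs_def])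
  \<comment> \<open>continuous on the whole space, since \<open>f\<close> vanishes where \<open>\<beta>\<close> becomes small\<close>
  define q where "q x = (if norm x < S then f x / \<beta> x else 0)" for x
  have "continuous_on ({x. norm x < S} \<union> {x. norm x > R}) q"
  proof (rule continuous_on_open_Un)
    show "open {x::real^'n. norm x < S}" by (intro open_Collect_less continuous_intros)
    show "open {x::real^'n. norm x > R}" by (intro open_Collect_less continuous_intros)
    have "continuous_on {x. norm x < S} (\<lambda>x. f x / \<beta> x)"
      using \<beta>_pos by (intro continuous_on_divide \<beta>_cont continuous_on_subset[OF f]) force+
    then show "continuous_on {x. norm x < S} q"
      by (rule continuous_on_eq) (simp add: q_def)
    have "continuous_on {x::real^'n. norm x > R} (\<lambda>x. 0)" by simp
    then show "continuous_on {x. norm x > R} q"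
      by (rule continuous_on_eq) (simp add: q_def supp)
  qed
  moreover have "{x::real^'n. norm x < S} \<union> {x. norm x > R} = UNIV" using S by auto
  ultimately have "continuous_on (cball 0 S) q" using continuous_on_subset by (metis subset_UNIV)
  then obtain p where p: "real_polynomial_function p" "\<And>x. x \<in> cball 0 S \<Longrightarrow> \<bar>q x - p x\<bar> < e"
    using Stone_Weierstrass_real_polynomial_function[OF compact_cball _ e] by blast
  show ?thesis
  proof
    have "compact (closure {x. p x * \<beta> x \<noteq> 0})"
    proof -
      have "{x. p x * \<beta> x \<noteq> 0} \<subseteq> cball 0 S" using \<beta>_0 by force
      from bounded_subset[OF bounded_cball this] show ?thesis by (simp only: compact_closure)
    qed
    then show "(\<lambda>x. p x * \<beta> x) \<in> test_functions"
      unfolding test_functions_def \<beta>_def using C_k_bump_polynomial[OF p(1)] by blast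
    show "\<bar>p x * \<beta> x - f x\<bar> \<le> e" for x
    proof (cases "norm x < S")
      case True
      then have "p x * \<beta> x - f x = \<beta> x * (p x - q x)"
        using \<beta>_pos[OF True] by (simp add: q_def field_simps)
      also have "\<bar>\<dots>\<bar> \<le> 1 * e"
        unfolding abs_mult using \<beta>_le[of x] p(2)[of x] True
        by (intro mult_mono) (auto simp: abs_minus_commute)
      finally show ?thesis by simp
    next
      case False
      then show ?thesis using \<beta>_0 supp S e by simp
    qed
  qed
qed

text \<open>Cutting off the values between \<open>-e/2\<close> and \<open>e/2\<close> changes \<open>f\<close> by at most \<open>e/2\<close> and makes its support bounded.\<close>
lemma test_functions_dense_C0:
  fixes f :: "real^'n::finite \<Rightarrow> real"
  assumes f: "continuous_on UNIV f" and lim: "(f \<longlongrightarrow> 0) at_infinity" and e: "e > 0"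
  obtains \<psi> where "\<psi> \<in> test_functions" "\<And>x. \<bar>\<psi> x - f x\<bar> \<le> e"
proof -
  \<comment> \<open>soft thresholding at level \<open>e/2\<close>\<close>
  define g where "g x = f x - max (- (e/2)) (min (e/2) (f x))" for x
  have "\<forall>\<^sub>F x in at_infinity. \<bar>f x\<bar> < e/2"
    using tendstoD[OF lim, of "e/2"] e by simp
  then obtain R where R: "\<And>x. norm x \<ge> R \<Longrightarrow> \<bar>f x\<bar> < e/2"
    by (auto simp: eventually_at_infinity)
  have "continuous_on UNIV g" unfolding g_def by (intro continuous_intros f)
  moreover have "g x = 0" if "norm x > R" for x
    using R[of x] that unfolding g_def by linarith
  ultimately obtain \<psi> where \<psi>: "\<psi> \<in> test_functions" "\<And>x. \<bar>\<psi> x - g x\<bar> \<le> e/2"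
    using test_functions_dense_compact_support[of g R "e/2"] e by auto
  have "\<bar>\<psi> x - f x\<bar> \<le> e" for x
  proof -
    have "\<bar>g x - f x\<bar> \<le> e/2" unfolding g_def using e by linarith
    then show ?thesis using \<psi>(2)[of x] by linarith
  qed
  with \<psi>(1) show ?thesis using that by blast
qed

lemma integrable_mult_bounded:
  fixes w f :: "'a \<Rightarrow> real"
  assumes "integrable M w" "f \<in> borel_measurable M" "\<And>x. \<bar>f x\<bar> \<le> K"
  shows "integrable M (\<lambda>x. w x * f x)"
proof (rule Bochner_Integration.integrable_bound)
  show "integrable M (\<lambda>x. K * w x)" using assms(1) by simp
  show "(\<lambda>x. w x * f x) \<in> borel_measurable M"
    using assms(2) borel_measurable_integrable[OF assms(1)] by (intro borel_measurable_times)
  have "0 \<le> K" using assms(3)[of undefined] by linarith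
  then show "AE x in M. norm (w x * f x) \<le> norm (K * w x)"
    using assms(3) by (auto simp: abs_mult mult.commute[of _ "\<bar>w _\<bar>"] intro!: mult_left_mono)
qed

text \<open>Duality between \<open>L\<^sup>1\<close> and the test functions. The sign of \<open>w\<close> is an almost everywhere limit of continuous
  functions; clamped to \<open>[-1, 1]\<close> and cut off at infinity they stay bounded by \<open>1\<close>, so dominated
  convergence recovers \<open>\<integral> \<bar>w\<bar>\<close> from the hypothesis, which extends to them by density.\<close>
lemma integral_abs_le_test_functions:
  fixes w :: "real^'n::finite \<Rightarrow> real"
  assumes w: "integrable lborel w"
    and M: "\<And>\<psi> K. \<psi> \<in> test_functions \<Longrightarrow> (\<And>x. \<bar>\<psi> x\<bar> \<le> K) \<Longrightarrow> (LINT x|lborel. w x * \<psi> x) \<le> M * K"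
  shows "(LINT x|lborel. \<bar>w x\<bar>) \<le> M"
proof -
  have M': "(LINT x|lborel. w x * f x) \<le> M"
    if f: "continuous_on UNIV f" and supp: "\<And>x. norm x > R \<Longrightarrow> f x = 0" and f1: "\<And>x. \<bar>f x\<bar> \<le> 1"
    for f :: "real^'n \<Rightarrow> real" and R
  proof (rule field_le_epsilon)
    fix e :: real assume e: "e > 0"
    define B where "B = \<bar>M\<bar> + (LINT x|lborel. \<bar>w x\<bar>) + 1"
    have B: "B > 0" unfolding B_def by (smt (verit) integral_nonneg_AE AE_I2 abs_ge_zero)
    define d where "d = e / B"
    have d: "d > 0" using e B by (simp add: d_def)
    obtain \<psi> where \<psi>: "\<psi> \<in> test_functions" "\<And>x. \<bar>\<psi> x - f x\<bar> \<le> d"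
      using test_functions_dense_compact_support[OF f supp d] by blast
    have fm: "f \<in> borel_measurable lborel" using f borel_measurable_continuous_onI by auto
    have \<psi>m: "\<psi> \<in> borel_measurable lborel" using test_function_borel[OF \<psi>(1)] by simp
    have \<psi>1: "\<bar>\<psi> x\<bar> \<le> 1 + d" for x using f1[of x] \<psi>(2)[of x] by linarith
    have int: "integrable lborel (\<lambda>x. w x * f x)" "integrable lborel (\<lambda>x. w x * \<psi> x)"
      using integrable_mult_bounded[OF w fm f1] integrable_mult_bounded[OF w \<psi>m \<psi>1] by auto
    have "(LINT x|lborel. w x * f x) - (LINT x|lborel. w x * \<psi> x) = (LINT x|lborel. w x * (f x - \<psi> x))"
      using int by (simp add: right_diff_distrib)
    also have "\<dots> \<le> (LINT x|lborel. \<bar>w x\<bar> * d)"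
    proof (rule integral_mono)
      show "integrable lborel (\<lambda>x. w x * (f x - \<psi> x))" using int by (simp add: right_diff_distrib)
      show "integrable lborel (\<lambda>x. \<bar>w x\<bar> * d)" using w by simp
      show "w x * (f x - \<psi> x) \<le> \<bar>w x\<bar> * d" for x
      proof -
        have "\<bar>w x * (f x - \<psi> x)\<bar> \<le> \<bar>w x\<bar> * d"
          unfolding abs_mult using \<psi>(2)[of x] by (intro mult_left_mono) (auto simp: abs_minus_commute)
        then show ?thesis by linarith
      qed
    qed
    also have "\<dots> = (LINT x|lborel. \<bar>w x\<bar>) * d" by simp
    finally have "(LINT x|lborel. w x * f x) \<le> M * (1 + d) + (LINT x|lborel. \<bar>w x\<bar>) * d"
      using M[OF \<psi>(1) \<psi>1] by linarith
    also have "\<dots> \<le> M + B * d" 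
    proof -
      have "(M + (LINT x|lborel. \<bar>w x\<bar>)) * d \<le> B * d"
        using d unfolding B_def by (intro mult_right_mono) auto
      then show ?thesis by (simp only: algebra_simps)
    qed
    finally show "(LINT x|lborel. w x * f x) \<le> M + e" using B by (simp add: d_def)
  qed
  have "(\<lambda>x. sgn (w x)) \<in> borel_measurable lebesgue"
  proof -
    have [measurable]: "w \<in> borel_measurable lborel" using w by simp
    have "(\<lambda>x. sgn (w x)) = (\<lambda>x. if w x > 0 then 1 else if w x < 0 then - 1 else 0)"
      by (auto simp: sgn_if)
    then show ?thesis by (intro measurable_completion) measurable
  qed
  then have "(\<lambda>x. sgn (w x)) measurable_on UNIV"
    by (intro lebesgue_measurable_imp_measurable_on) auto
  then obtain N g where N: "negligible N" and g: "\<And>n. continuous_on UNIV (g n)"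
    and lim: "\<And>x. x \<notin> N \<Longrightarrow> (\<lambda>n. g n x) \<longlonglongrightarrow> sgn (w x)"
    unfolding measurable_on_def by auto
  \<comment> \<open>a continuous cutoff, eventually equal to \<open>1\<close> at every point\<close>
  define cut :: "nat \<Rightarrow> real^'n \<Rightarrow> real" where "cut n x = max 0 (min 1 (real n - norm x))" for n x
  define f where "f n x = max (- 1) (min 1 (g n x)) * cut n x" for n x
  have f1: "\<bar>f n x\<bar> \<le> 1" for n x
  proof -
    have "\<bar>max (- 1) (min 1 (g n x))\<bar> \<le> 1" "\<bar>cut n x\<bar> \<le> 1" unfolding cut_def by linarith+
    then show ?thesis unfolding f_def abs_mult by (intro mult_le_one) auto
  qed
  have fc: "continuous_on UNIV (f n)" for n
    unfolding f_def cut_def by (intro continuous_intros g)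
  have le: "(LINT x|lborel. w x * f n x) \<le> M" for n
    by (rule M'[OF fc _ f1, of "real n"]) (auto simp: f_def cut_def)
  have ae: "AE x in lborel. x \<notin> N"
    using AE_not_in[OF N[unfolded negligible_iff_null_sets]] unfolding AE_completion_iff .
  have flim: "(\<lambda>n. w x * f n x) \<longlonglongrightarrow> \<bar>w x\<bar>" if "x \<notin> N" for x
  proof -
    have "\<forall>\<^sub>F n in sequentially. cut n x = 1"
    proof -
      have "cut n x = 1" if "n \<ge> nat \<lceil>norm x + 1\<rceil>" for n
      proof -
        have "norm x + 1 \<le> real n" using that by linarith
        then show ?thesis unfolding cut_def by auto
      qed
      then show ?thesis using eventually_sequentially by blast
    qed
    then have "(\<lambda>n. cut n x) \<longlonglongrightarrow> 1" by (rule tendsto_eventually)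
    then have "(\<lambda>n. w x * f n x) \<longlonglongrightarrow> w x * (max (- 1) (min 1 (sgn (w x))) * 1)"
      unfolding f_def by (intro tendsto_intros lim that)
    moreover have "w x * (max (- 1) (min 1 (sgn (w x))) * 1) = \<bar>w x\<bar>"
      by (simp add: sgn_if)
    ultimately show ?thesis by simp
  qed
  have "(\<lambda>n. LINT x|lborel. w x * f n x) \<longlonglongrightarrow> (LINT x|lborel. \<bar>w x\<bar>)"
  proof (rule integral_dominated_convergence)
    show "integrable lborel (\<lambda>x. \<bar>w x\<bar>)" using w by simp
    show "(\<lambda>x. \<bar>w x\<bar>) \<in> borel_measurable lborel" using w by simp
    show "(\<lambda>x. w x * f n x) \<in> borel_measurable lborel" for n
      using w borel_measurable_continuous_onI[OF fc] by (intro borel_measurable_times) auto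
    show "AE x in lborel. (\<lambda>n. w x * f n x) \<longlonglongrightarrow> \<bar>w x\<bar>"
      using ae flim by (auto elim: eventually_mono)
    show "AE x in lborel. norm (w x * f n x) \<le> \<bar>w x\<bar>" for n
      using f1 by (auto simp: abs_mult mult_left_le)
  qed
  then show ?thesis by (rule LIMSEQ_le_const2) (use le in auto)
qed

section \<open>Rotation invariance and fourth moments of isotropic densities\<close>

lemma lborel_reflect: "distr lborel borel (\<lambda>x. - x) = (lborel :: 'a::euclidean_space measure)"
proof -
  have "(lborel :: 'a measure) = density (distr lborel borel (\<lambda>x. 0 + (-1) *\<^sub>R x)) (\<lambda>_. 1)"
    using lborel_affine[of "-1" "0::'a"] by simp
  then show ?thesis by (simp add: density_1)
qed

text \<open>Uniqueness of Haar measure on a Euclidean space. Evaluate \<open>\<integral>\<integral> 1\<^sub>A(x) 1\<^sub>B(x + y) dy dM(x)\<close> in two ways: integrating over \<open>y\<close>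
  first gives the left-hand side; substituting \<open>x - y\<close> for \<open>x\<close> in the inner integral of the other order, and
  then \<open>-y\<close> for \<open>y\<close>, gives the right-hand side.\<close>
lemma translation_invariant_measure_proportional_lborel:
  fixes M :: "'a::euclidean_space measure"
  assumes sets: "sets M = sets borel" and sf: "sigma_finite_measure M"
    and inv: "\<And>c. distr M borel ((+) c) = M"
    and A: "A \<in> sets borel" and B: "B \<in> sets borel"
  shows "emeasure M A * emeasure lborel B = emeasure M B * emeasure lborel A"
proof -
  interpret M: sigma_finite_measure M by fact
  interpret P: pair_sigma_finite M "lborel :: 'a measure" ..
  have meas: "f \<in> borel_measurable M" if "f \<in> borel_measurable borel" for f :: "'a \<Rightarrow> ennreal"
    unfolding measurable_cong_sets[OF sets refl] by (rule that)
  have pair: "sets (M \<Otimes>\<^sub>M (lborel :: 'a measure)) = sets (borel \<Otimes>\<^sub>M borel)"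
    by (rule sets_pair_measure_cong) (simp_all add: sets)
  have pmeas: "case_prod f \<in> borel_measurable (M \<Otimes>\<^sub>M lborel)"
    if "case_prod f \<in> borel_measurable (borel \<Otimes>\<^sub>M borel)" for f :: "'a \<Rightarrow> 'a \<Rightarrow> ennreal"
    unfolding measurable_cong_sets[OF pair refl] by (rule that)
  have shiftL: "(\<integral>\<^sup>+y. f (x + y) \<partial>lborel) = (\<integral>\<^sup>+y. f y \<partial>lborel)"
    if "f \<in> borel_measurable borel" for f :: "'a \<Rightarrow> ennreal" and x
    using nn_integral_distr[of "(+) x" lborel borel f] lborel_distr_plus[of x] that by simp
  have reflL: "(\<integral>\<^sup>+y. f (- y) \<partial>lborel) = (\<integral>\<^sup>+y. f y \<partial>lborel)"
    if "f \<in> borel_measurable borel" for f :: "'a \<Rightarrow> ennreal"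
    using nn_integral_distr[of uminus lborel borel f] that by (simp add: lborel_reflect)
  have shiftM: "(\<integral>\<^sup>+y. f (x + y) \<partial>M) = (\<integral>\<^sup>+y. f y \<partial>M)"
    if "f \<in> borel_measurable borel" for f :: "'a \<Rightarrow> ennreal" and x
  proof -
    have "(+) x \<in> measurable M borel" unfolding measurable_cong_sets[OF sets refl] by simp
    from nn_integral_distr[OF this, of f] show ?thesis 
      using inv[of x] meas[OF that] by simp
  qed
  note [measurable] = A B
  have "emeasure M A * emeasure lborel B = (\<integral>\<^sup>+x. indicator A x * emeasure lborel B \<partial>M)"
    using A sets by (subst nn_integral_multc) (auto intro: meas)
  also have "\<dots> = (\<integral>\<^sup>+x. (\<integral>\<^sup>+y. indicator A x * indicator B (x + y) \<partial>lborel) \<partial>M)"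
  proof (rule nn_integral_cong)
    fix x
    have "(\<integral>\<^sup>+y. indicator A x * indicator B (x + y) \<partial>lborel) = indicator A x * (\<integral>\<^sup>+y. indicator B (x + y) \<partial>lborel)"
      by (rule nn_integral_cmult) simp
    also have "(\<integral>\<^sup>+y. indicator B (x + y) \<partial>lborel) = emeasure lborel B"
      using shiftL[of "indicator B" x] by simp
    finally show "indicator A x * emeasure lborel B = (\<integral>\<^sup>+y. indicator A x * indicator B (x + y) \<partial>lborel)" ..
  qed
  also have "\<dots> = (\<integral>\<^sup>+y. (\<integral>\<^sup>+x. indicator A x * indicator B (x + y) \<partial>M) \<partial>lborel)"
    by (rule P.Fubini'[symmetric]) (rule pmeas, measurable)
  also have "\<dots> = (\<integral>\<^sup>+y. (\<integral>\<^sup>+x. indicator B x * indicator A (x - y) \<partial>M) \<partial>lborel)"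
  proof (rule nn_integral_cong)
    fix y
    show "(\<integral>\<^sup>+x. indicator A x * indicator B (x + y) \<partial>M) = (\<integral>\<^sup>+x. indicator B x * indicator A (x - y) \<partial>M)"
      using shiftM[of "\<lambda>x. indicator A x * indicator B (x + y)" "- y"] by (simp add: mult.commute)
  qed
  also have "\<dots> = (\<integral>\<^sup>+x. (\<integral>\<^sup>+y. indicator B x * indicator A (x - y) \<partial>lborel) \<partial>M)"
    by (rule P.Fubini') (rule pmeas, measurable)
  also have "\<dots> = (\<integral>\<^sup>+x. indicator B x * emeasure lborel A \<partial>M)"
  proof (rule nn_integral_cong)
    fix x
    have "(\<integral>\<^sup>+y. indicator B x * indicator A (x - y) \<partial>lborel) = indicator B x * (\<integral>\<^sup>+y. indicator A (x - y) \<partial>lborel)"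
      by (rule nn_integral_cmult) simp
    also have "(\<integral>\<^sup>+y. indicator A (x - y) \<partial>lborel) = (\<integral>\<^sup>+y. indicator A (x + y) \<partial>lborel)"
      using reflL[of "\<lambda>y. indicator A (x + y)"] by simp
    also have "\<dots> = emeasure lborel A"
      using shiftL[of "indicator A" x] by simp
    finally show "(\<integral>\<^sup>+y. indicator B x * indicator A (x - y) \<partial>lborel) = indicator B x * emeasure lborel A" .
  qed
  also have "\<dots> = emeasure M B * emeasure lborel A"
    using B sets by (subst nn_integral_multc) (auto intro: meas)
  finally show ?thesis .
qed

lemma orthogonal_transformation_measurable:
  fixes T :: "'a::euclidean_space \<Rightarrow> 'a"
  assumes "orthogonal_transformation T"
  shows "T \<in> borel_measurable borel"
  using assms by (intro borel_measurable_continuous_onI linear_continuous_on)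
    (simp add: linear_conv_bounded_linear[symmetric] orthogonal_transformation_linear)

text \<open>The image measure is again translation invariant, hence proportional to Lebesgue measure, and the factor is \<open>1\<close>
  because the unit ball is mapped to itself.\<close>
lemma lborel_orthogonal_transformation:
  fixes T :: "'a::euclidean_space \<Rightarrow> 'a"
  assumes T: "orthogonal_transformation T"
  shows "distr lborel borel T = lborel"
proof -
  let ?M = "distr lborel borel T :: 'a measure"
  note Tm = orthogonal_transformation_measurable[OF T]
  have Tm': "T \<in> measurable lborel borel" using Tm by simp
  have ball: "emeasure ?M (ball 0 r) = emeasure lborel (ball (0::'a) r)" for r
  proof -
    have "T -` ball 0 r = ball 0 r" using orthogonal_transformation_norm[OF T] by auto
    then show ?thesis using Tm' by (simp add: emeasure_distr)
  qed
  have finite_ball: "emeasure lborel (ball (0::'a) r) < \<infinity>" for r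
    using emeasure_bounded_finite[OF bounded_ball] by blast
  have sf: "sigma_finite_measure ?M"
  proof
    show "\<exists>A. countable A \<and> A \<subseteq> sets ?M \<and> \<Union>A = space ?M \<and> (\<forall>a\<in>A. emeasure ?M a \<noteq> \<infinity>)"
    proof (intro exI[of _ "range (\<lambda>n::nat. ball 0 (real n))"] conjI ballI)
      show "\<Union>(range (\<lambda>n::nat. ball (0::'a) (real n))) = space ?M"
        using reals_Archimedean2 by auto
      show "emeasure ?M a \<noteq> \<infinity>" if "a \<in> range (\<lambda>n::nat. ball 0 (real n))" for a
        using that ball finite_ball by (auto simp: less_top)
    qed auto
  qed
  have inv: "distr ?M borel ((+) c) = ?M" for c
  proof -
    obtain d where d: "c = T d" using orthogonal_transformation_surj[OF T] by (metis surjD)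
    have comp: "(+) c \<circ> T = T \<circ> (+) d"
      using orthogonal_transformation_linear[OF T] d by (auto simp: linear_add)
    have "distr ?M borel ((+) c) = distr lborel borel ((+) c \<circ> T)"
      using Tm' by (intro distr_distr) auto
    also have "\<dots> = distr (distr lborel borel ((+) d)) borel T"
      unfolding comp using Tm by (intro distr_distr[symmetric]) auto
    finally show ?thesis by (simp only: lborel_distr_plus)
  qed
  show ?thesis
  proof (rule measure_eqI)
    fix A assume "A \<in> sets ?M"
    then have A: "A \<in> sets borel" by simp
    let ?b = "emeasure lborel (ball (0::'a) 1)"
    have "emeasure ?M A * ?b = emeasure lborel A * ?b"
      using translation_invariant_measure_proportional_lborel[OF _ sf inv A, of "ball 0 1"] ball[of 1]
      by (simp add: mult.commute)
    moreover have "?b \<noteq> 0"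
      using content_ball_pos[of 1 "0::'a"] by (auto simp: measure_def)
    moreover have "?b \<noteq> top" using finite_ball[of 1] by simp
    ultimately show "emeasure ?M A = emeasure lborel A"
      by (metis ennreal_mult_divide_eq)
  qed simp
qed

text \<open>The quotient by \<open>\<parallel>h\<parallel>\<^sup>4\<close> makes these moments of the direction of \<open>h\<close>.\<close>
definition fourth_moment :: "('a::euclidean_space \<Rightarrow> real) \<Rightarrow> 'a \<Rightarrow> 'a \<Rightarrow> 'a \<Rightarrow> 'a \<Rightarrow> real" where
  "fourth_moment r a b c d =
     (LINT h|lborel. (a \<bullet> h) * (b \<bullet> h) * (c \<bullet> h) * (d \<bullet> h) / (norm h) ^ 4 * r h)"

lemma fourth_moment_integrable:
  fixes r :: "'a::euclidean_space \<Rightarrow> real"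
  assumes r: "integrable lborel r"
  shows "integrable lborel (\<lambda>h. (a \<bullet> h) * (b \<bullet> h) * (c \<bullet> h) * (d \<bullet> h) / (norm h) ^ 4 * r h)"
proof (rule Bochner_Integration.integrable_bound)
  let ?K = "norm a * norm b * norm c * norm d"
  show "integrable lborel (\<lambda>h. ?K * r h)" using r by simp
  have [measurable]: "r \<in> borel_measurable borel" using r by simp
  show "(\<lambda>h. (a \<bullet> h) * (b \<bullet> h) * (c \<bullet> h) * (d \<bullet> h) / (norm h) ^ 4 * r h) \<in> borel_measurable lborel"
    by measurable
  have "norm ((a \<bullet> h) * (b \<bullet> h) * (c \<bullet> h) * (d \<bullet> h) / (norm h) ^ 4 * r h) \<le> norm (?K * r h)" for h
  proof (cases "h = 0")
    case False
    have "\<bar>(a \<bullet> h) * (b \<bullet> h) * (c \<bullet> h) * (d \<bullet> h)\<bar>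
        \<le> (norm a * norm h) * (norm b * norm h) * (norm c * norm h) * (norm d * norm h)"
      unfolding abs_mult by (intro mult_mono Cauchy_Schwarz_ineq2) auto
    also have "\<dots> = ?K * norm h ^ 4" by (simp add: power4_eq_xxxx)
    finally have "\<bar>(a \<bullet> h) * (b \<bullet> h) * (c \<bullet> h) * (d \<bullet> h)\<bar> / norm h ^ 4 \<le> ?K"
      using False by (simp add: divide_le_eq)
    then have "\<bar>(a \<bullet> h) * (b \<bullet> h) * (c \<bullet> h) * (d \<bullet> h)\<bar> / norm h ^ 4 * \<bar>r h\<bar> \<le> ?K * \<bar>r h\<bar>"
      by (intro mult_right_mono) auto
    then show ?thesis by (simp add: abs_mult)
  qed simp
  then show "AE h in lborel. norm ((a \<bullet> h) * (b \<bullet> h) * (c \<bullet> h) * (d \<bullet> h) / (norm h) ^ 4 * r h) \<le> norm (?K * r h)"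
    by simp
qed

lemma polarize4:
  fixes a b c d :: real
  shows "192 * (a * b * c * d) = (a+b+c+d)^4 - (a+b+c-d)^4 - (a+b-c+d)^4 - (a-b+c+d)^4
     + (a+b-c-d)^4 + (a-b+c-d)^4 + (a-b-c+d)^4 - (a-b-c-d)^4"
  by algebra

text \<open>The combination that recovers a product of four numbers from fourth powers, applied to
  \<open>\<parallel>v\<parallel>\<^sup>4 = (v \<bullet> v)\<^sup>2\<close>; it turns a rotation invariant quartic form into its symmetric four-linear form.\<close>
lemma polarize4_norm:
  fixes a b c d :: "'a::real_inner"
  shows "norm (a+b+c+d)^4 - norm (a+b+c-d)^4 - norm (a+b-c+d)^4 - norm (a-b+c+d)^4
     + norm (a+b-c-d)^4 + norm (a-b+c-d)^4 + norm (a-b-c+d)^4 - norm (a-b-c-d)^4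
     = 64 * ((a \<bullet> b) * (c \<bullet> d) + (a \<bullet> c) * (b \<bullet> d) + (a \<bullet> d) * (b \<bullet> c))"
proof -
  have poly: "(aa + bb + cc + dd + 2 * (bc + ab + ac + ad + bd + cd))^2 - (aa + bb + cc + dd + 2 * (bc + ab + ac - ad - bd - cd))^2
      - (aa + bb + cc + dd + 2 * (- bc + ab - ac + ad + bd - cd))^2
      - (aa + bb + cc + dd + 2 * (- bc - ab + ac + ad - bd + cd))^2
      + (aa + bb + cc + dd + 2 * (- bc + ab - ac - ad - bd + cd))^2
      + (aa + bb + cc + dd + 2 * (- bc - ab + ac - ad + bd - cd))^2
      + (aa + bb + cc + dd + 2 * (bc - ab - ac + ad - bd - cd))^2
      - (aa + bb + cc + dd + 2 * (bc - ab - ac - ad + bd + cd))^2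
     = 64 * (ab * cd + ac * bd + ad * bc)" for aa bb cc dd ab ac ad bc bd cd :: real
    by algebra
  have n4: "x \<bullet> x = y \<Longrightarrow> norm x ^ 4 = y^2" for x :: 'a and y
    using power_mult[of "norm x" 2 2] by (simp add: power2_norm_eq_inner)
  note expand = inner_add_left inner_add_right inner_diff_left inner_diff_right inner_commute algebra_simps
  have e0: "norm (a + b + c + d) ^ 4 = ((a \<bullet> a) + (b \<bullet> b) + (c \<bullet> c) + (d \<bullet> d) + 2 * ((b \<bullet> c) + (a \<bullet> b) + (a \<bullet> c) + (a \<bullet> d) + (b \<bullet> d) + (c \<bullet> d)))^2"
    by (rule n4) (simp add: expand)
  have e1: "norm (a + b + c - d) ^ 4 = ((a \<bullet> a) + (b \<bullet> b) + (c \<bullet> c) + (d \<bullet> d) + 2 * ((b \<bullet> c) + (a \<bullet> b) + (a \<bullet> c) - (a \<bullet> d) - (b \<bullet> d) - (c \<bullet> d)))^2"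
    by (rule n4) (simp add: expand)
  have e2: "norm (a + b - c + d) ^ 4 = ((a \<bullet> a) + (b \<bullet> b) + (c \<bullet> c) + (d \<bullet> d) + 2 * (- (b \<bullet> c) + (a \<bullet> b) - (a \<bullet> c) + (a \<bullet> d) + (b \<bullet> d) - (c \<bullet> d)))^2"
    by (rule n4) (simp add: expand)
  have e3: "norm (a - b + c + d) ^ 4 = ((a \<bullet> a) + (b \<bullet> b) + (c \<bullet> c) + (d \<bullet> d) + 2 * (- (b \<bullet> c) - (a \<bullet> b) + (a \<bullet> c) + (a \<bullet> d) - (b \<bullet> d) + (c \<bullet> d)))^2"
    by (rule n4) (simp add: expand)
  have e4: "norm (a + b - c - d) ^ 4 = ((a \<bullet> a) + (b \<bullet> b) + (c \<bullet> c) + (d \<bullet> d) + 2 * (- (b \<bullet> c) + (a \<bullet> b) - (a \<bullet> c) - (a \<bullet> d) - (b \<bullet> d) + (c \<bullet> d)))^2"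
    by (rule n4) (simp add: expand)
  have e5: "norm (a - b + c - d) ^ 4 = ((a \<bullet> a) + (b \<bullet> b) + (c \<bullet> c) + (d \<bullet> d) + 2 * (- (b \<bullet> c) - (a \<bullet> b) + (a \<bullet> c) - (a \<bullet> d) + (b \<bullet> d) - (c \<bullet> d)))^2"
    by (rule n4) (simp add: expand)
  have e6: "norm (a - b - c + d) ^ 4 = ((a \<bullet> a) + (b \<bullet> b) + (c \<bullet> c) + (d \<bullet> d) + 2 * ((b \<bullet> c) - (a \<bullet> b) - (a \<bullet> c) + (a \<bullet> d) - (b \<bullet> d) - (c \<bullet> d)))^2"
    by (rule n4) (simp add: expand)
  have e7: "norm (a - b - c - d) ^ 4 = ((a \<bullet> a) + (b \<bullet> b) + (c \<bullet> c) + (d \<bullet> d) + 2 * ((b \<bullet> c) - (a \<bullet> b) - (a \<bullet> c) - (a \<bullet> d) + (b \<bullet> d) + (c \<bullet> d)))^2"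
    by (rule n4) (simp add: expand)
  show ?thesis unfolding e0 e1 e2 e3 e4 e5 e6 e7 by (rule poly)
qed

text \<open>By invariance, \<open>Q v = \<integral> (v \<bullet> h)\<^sup>4 / \<parallel>h\<parallel>\<^sup>4 r(h) dh\<close> depends only on \<open>\<parallel>v\<parallel>\<close>, so it is a multiple of \<open>\<parallel>v\<parallel>\<^sup>4\<close>, and
  polarization gives all fourth moments up to this factor. The factor follows from
  \<open>\<Sum>\<^sub>i\<^sub>k h\<^sub>i\<^sup>2 h\<^sub>k\<^sup>2 = \<parallel>h\<parallel>\<^sup>4\<close> and the mass of \<open>r\<close>. Invariance is required only almost everywhere, because a Borel representative of a
  radial Lebesgue measurable function need not be radial.\<close>
lemma fourth_moment_isotropic:
  fixes r :: "real^'n::finite \<Rightarrow> real"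
  assumes r: "integrable lborel r"
    and inv: "\<And>T. orthogonal_transformation T \<Longrightarrow> AE h in lborel. r (T h) = r h"
    and mass: "(LINT h|lborel. r h) = 1"
  shows "real CARD('n) * (real CARD('n) + 2) * fourth_moment r a b c d
     = (a \<bullet> b) * (c \<bullet> d) + (a \<bullet> c) * (b \<bullet> d) + (a \<bullet> d) * (b \<bullet> c)"
proof -
  have [measurable]: "r \<in> borel_measurable borel" using r by simp
  define Q where "Q v = (LINT h|lborel. (v \<bullet> h)^4 / (norm h) ^ 4 * r h)" for v
  have Q_int: "integrable lborel (\<lambda>h. (v \<bullet> h)^4 / (norm h) ^ 4 * r h)" for v
    using fourth_moment_integrable[OF r, of v v v v] by (simp add: power4_eq_xxxx mult.assoc)
  have Q_norm: "Q v = Q w" if vw: "norm v = norm w" for v w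
  proof -
    obtain T where T: "orthogonal_transformation T" "T v = w"
      using orthogonal_transformation_exists[OF vw] by blast
    have [measurable]: "T \<in> borel_measurable borel" by (rule orthogonal_transformation_measurable[OF T(1)])
    have "Q w = (LINT h|distr lborel borel T. (w \<bullet> h)^4 / (norm h) ^ 4 * r h)"
      unfolding Q_def lborel_orthogonal_transformation[OF T(1)] ..
    also have "\<dots> = (LINT h|lborel. (w \<bullet> T h)^4 / (norm (T h)) ^ 4 * r (T h))"
      by (rule integral_distr) measurable
    also have "\<dots> = (LINT h|lborel. (v \<bullet> h)^4 / (norm h) ^ 4 * r h)"
    proof (rule integral_cong_AE)
      have "w \<bullet> T h = v \<bullet> h" "norm (T h) = norm h" for h
        using T unfolding orthogonal_transformation_def
        by (auto simp: orthogonal_transformation_norm[OF T(1)])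
      then show "AE h in lborel. (w \<bullet> T h)^4 / (norm (T h)) ^ 4 * r (T h) = (v \<bullet> h)^4 / (norm h) ^ 4 * r h"
        using inv[OF T(1)] by (auto elim: eventually_mono)
    qed measurable
    finally show ?thesis by (simp add: Q_def)
  qed
  define e0 :: "real^'n" where "e0 = axis undefined 1"
  have Q_eq: "Q v = Q e0 * norm v ^ 4" for v
  proof -
    have "Q v = Q (norm v *\<^sub>R e0)" by (rule Q_norm) (simp add: e0_def norm_axis_1)
    also have "\<dots> = (LINT h|lborel. norm v ^ 4 * ((e0 \<bullet> h)^4 / (norm h) ^ 4 * r h))"
      unfolding Q_def by (simp add: power_mult_distrib mult.assoc)
    also have "\<dots> = norm v ^ 4 * Q e0" unfolding Q_def by (rule integral_mult_right_zero)
    also have "\<dots> = Q e0 * norm v ^ 4" by (rule mult.commute)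
    finally show ?thesis .
  qed
  have pol: "192 * fourth_moment r a b c d = Q (a+b+c+d) - Q (a+b+c-d) - Q (a+b-c+d) - Q (a-b+c+d)
     + Q (a+b-c-d) + Q (a-b+c-d) + Q (a-b-c+d) - Q (a-b-c-d)" for a b c d
  proof -
    have "192 * fourth_moment r a b c d =
       (LINT h|lborel. 192 * ((a \<bullet> h) * (b \<bullet> h) * (c \<bullet> h) * (d \<bullet> h)) / (norm h) ^ 4 * r h)"
      unfolding fourth_moment_def by (subst integral_mult_right_zero[symmetric]) (simp add: mult.assoc)
    also have "\<dots> = (LINT h|lborel.
       ((a+b+c+d) \<bullet> h)^4 / (norm h) ^ 4 * r h - ((a+b+c-d) \<bullet> h)^4 / (norm h) ^ 4 * r h
      - ((a+b-c+d) \<bullet> h)^4 / (norm h) ^ 4 * r h - ((a-b+c+d) \<bullet> h)^4 / (norm h) ^ 4 * r h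
      + ((a+b-c-d) \<bullet> h)^4 / (norm h) ^ 4 * r h + ((a-b+c-d) \<bullet> h)^4 / (norm h) ^ 4 * r h
      + ((a-b-c+d) \<bullet> h)^4 / (norm h) ^ 4 * r h - ((a-b-c-d) \<bullet> h)^4 / (norm h) ^ 4 * r h)"
      unfolding polarize4 inner_add_left inner_diff_left diff_divide_distrib add_divide_distrib
        left_diff_distrib distrib_right ..
    also have "\<dots> = Q (a+b+c+d) - Q (a+b+c-d) - Q (a+b-c+d) - Q (a-b+c+d)
     + Q (a+b-c-d) + Q (a-b+c-d) + Q (a-b-c+d) - Q (a-b-c-d)"
      unfolding Q_def by (simp only: Q_int Bochner_Integration.integral_diff Bochner_Integration.integral_add
          Bochner_Integration.integrable_diff Bochner_Integration.integrable_add)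
    finally show ?thesis .
  qed
  have m: "3 * fourth_moment r a b c d = Q e0 * ((a \<bullet> b) * (c \<bullet> d) + (a \<bullet> c) * (b \<bullet> d) + (a \<bullet> d) * (b \<bullet> c))"
    for a b c d
  proof -
    let ?S = "(a \<bullet> b) * (c \<bullet> d) + (a \<bullet> c) * (b \<bullet> d) + (a \<bullet> d) * (b \<bullet> c)"
    have "192 * fourth_moment r a b c d = Q e0 * (norm (a+b+c+d)^4 - norm (a+b+c-d)^4 - norm (a+b-c+d)^4 - norm (a-b+c+d)^4
     + norm (a+b-c-d)^4 + norm (a-b+c-d)^4 + norm (a-b-c+d)^4 - norm (a-b-c-d)^4)"
      unfolding pol by (subst (1 2 3 4 5 6 7 8) Q_eq) (simp only: right_diff_distrib distrib_left)
    also have "\<dots> = Q e0 * (64 * ?S)" unfolding polarize4_norm ..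
    finally have "64 * (3 * fourth_moment r a b c d) = 64 * (Q e0 * ?S)" by simp
    then show ?thesis by simp
  qed
  have norm4: "norm h ^ 4 = (\<Sum>i\<in>UNIV. \<Sum>k\<in>UNIV. (h $ i)\<^sup>2 * (h $ k)\<^sup>2)" for h :: "real^'n"
  proof -
    have "norm h ^ 4 = (\<Sum>i\<in>UNIV. (h $ i)\<^sup>2)\<^sup>2"
      using power_mult[of "norm h" 2 2] power2_norm_eq_inner[of h]
      by (simp add: inner_vec_def power2_eq_square)
    then show ?thesis by (simp add: power2_eq_square sum_product)
  qed
  have one: "(\<Sum>i\<in>UNIV. \<Sum>k\<in>UNIV. fourth_moment r (axis i 1) (axis i 1) (axis k 1) (axis k 1)) = 1"
  proof -
    have "(\<Sum>i\<in>UNIV. \<Sum>k\<in>UNIV. fourth_moment r (axis i 1) (axis i 1) (axis k 1) (axis k 1))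
       = (LINT h|lborel. (\<Sum>i\<in>UNIV. \<Sum>k\<in>UNIV. (axis i 1 \<bullet> h) * (axis i 1 \<bullet> h) * (axis k 1 \<bullet> h) * (axis k 1 \<bullet> h) / (norm h) ^ 4 * r h))"
      unfolding fourth_moment_def
      by (simp only: Bochner_Integration.integral_sum Bochner_Integration.integrable_sum fourth_moment_integrable[OF r])
    also have "\<dots> = (LINT h|lborel. r h)"
    proof (rule integral_cong_AE)
      have "(\<Sum>i\<in>UNIV. \<Sum>k\<in>UNIV. (axis i 1 \<bullet> h) * (axis i 1 \<bullet> h) * (axis k 1 \<bullet> h) * (axis k 1 \<bullet> h) / (norm h) ^ 4 * r h) = r h"
        if "h \<noteq> 0" for h
      proof -
        have "(\<Sum>i\<in>UNIV. \<Sum>k\<in>UNIV. (axis i 1 \<bullet> h) * (axis i 1 \<bullet> h) * (axis k 1 \<bullet> h) * (axis k 1 \<bullet> h) / (norm h) ^ 4 * r h)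
          = norm h ^ 4 / norm h ^ 4 * r h"
          by (subst (2) norm4) (simp add: inner_axis' power2_eq_square sum_divide_distrib sum_distrib_right mult.assoc)
        then show ?thesis using that by simp
      qed
      moreover have "AE h in lborel. h \<noteq> (0 :: real^'n)" by (rule AE_lborel_singleton)
      ultimately show "AE h in lborel. (\<Sum>i\<in>UNIV. \<Sum>k\<in>UNIV. (axis i 1 \<bullet> h) * (axis i 1 \<bullet> h) * (axis k 1 \<bullet> h) * (axis k 1 \<bullet> h) / (norm h) ^ 4 * r h) = r h"
        by (auto elim: eventually_mono)
    qed measurable
    finally show ?thesis using mass by simp
  qed
  have "3 = (\<Sum>i\<in>UNIV. \<Sum>k\<in>UNIV. 3 * fourth_moment r (axis i 1) (axis i 1) (axis k (1::real)) (axis k 1))"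
    using one by (simp flip: sum_distrib_left)
  also have "\<dots> = (\<Sum>i\<in>(UNIV::'n set). \<Sum>k\<in>(UNIV::'n set). Q e0 * (1 + (if i = k then 2 else 0)))"
    unfolding m by (intro sum.cong refl) (auto simp: inner_axis_axis)
  also have "\<dots> = Q e0 * (real CARD('n) * (real CARD('n) + 2))"
    by (simp add: sum.distrib algebra_simps flip: sum_distrib_left)
  finally have "3 = Q e0 * (real CARD('n) * (real CARD('n) + 2))" .
  then have "3 * (real CARD('n) * (real CARD('n) + 2) * fourth_moment r a b c d)
     = 3 * ((a \<bullet> b) * (c \<bullet> d) + (a \<bullet> c) * (b \<bullet> d) + (a \<bullet> d) * (b \<bullet> c))"
    using m[of a b c d] by algebra
  then show ?thesis by simp
qed

section \<open>The kernel and the derivatives of a translated pairing\<close>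

text \<open>One entry of the matrix that multiplies the second difference and \<open>\<rho>\<close>, with both divisions by \<open>\<parallel>h\<parallel>\<^sup>2\<close> collected.\<close>
definition hessian_kernel :: "'n::finite \<Rightarrow> 'n \<Rightarrow> real^'n \<Rightarrow> real" where
  "hessian_kernel i j h =
     (h $ i * h $ j - (norm h)\<^sup>2 / (real CARD('n) + 2) * (if i = j then 1 else 0)) / norm h ^ 4"

lemma hessian_integrand_component:
  "hessian_integrand r u x h $ i $ j = (u (x + h) - 2 * u x + u (x - h)) * (hessian_kernel i j h * r h)"
  by (simp add: hessian_integrand_def hessian_kernel_def outer_product_def mat_def
      power4_eq_xxxx power2_eq_square mult_ac)

lemma hessian_kernel_bound: "\<bar>hessian_kernel i j h\<bar> * (norm h)\<^sup>2 \<le> 2"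
proof (cases "h = 0")
  case False
  have 1: "\<bar>h $ i * h $ j\<bar> \<le> norm h * norm h"
    unfolding abs_mult by (intro mult_mono component_le_norm_cart) auto
  have 2: "(norm h)\<^sup>2 / (real CARD('a) + 2) * (if i = j then 1 else 0) \<le> (norm h)\<^sup>2"
    by (auto simp: divide_le_eq algebra_simps)
  have 3: "(norm h)\<^sup>2 / (real CARD('a) + 2) * (if i = j then 1 else 0) \<ge> 0" by auto
  have "\<bar>h $ i * h $ j - (norm h)\<^sup>2 / (real CARD('a) + 2) * (if i = j then 1 else 0)\<bar> \<le> 2 * (norm h)\<^sup>2"
    using 1 2 3 unfolding power2_eq_square by linarith
  then have "\<bar>hessian_kernel i j h\<bar> \<le> 2 * (norm h)\<^sup>2 / norm h ^ 4"
    unfolding hessian_kernel_def abs_divide by (simp add: divide_right_mono)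
  then have "\<bar>hessian_kernel i j h\<bar> * (norm h)\<^sup>2 \<le> 2 * (norm h)\<^sup>2 / norm h ^ 4 * (norm h)\<^sup>2"
    by (rule mult_right_mono) simp
  also have "\<dots> = 2" using False by (simp add: power4_eq_xxxx power2_eq_square)
  finally show ?thesis .
qed simp

lemma hessian_kernel_measurable [measurable]: "hessian_kernel i j \<in> borel_measurable borel"
  unfolding hessian_kernel_def by measurable

text \<open>Expanding with the isotropic fourth moments, the term \<open>\<delta>\<^sub>k\<^sub>l \<delta>\<^sub>i\<^sub>j\<close> produces the trace of \<open>S\<close>, which the
  correction \<open>\<parallel>h\<parallel>\<^sup>2 / (N + 2)\<close> in the kernel cancels; what remains is \<open>S i j + S j i\<close>.\<close>
lemma hessian_kernel_quadratic_form:
  fixes r :: "real^'n::finite \<Rightarrow> real"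
  assumes r: "integrable lborel r"
    and inv: "\<And>T. orthogonal_transformation T \<Longrightarrow> AE h in lborel. r (T h) = r h"
    and mass: "(LINT h|lborel. r h) = 1"
    and sym: "\<And>k l. S k l = S l k"
  shows "real CARD('n) * (real CARD('n) + 2) / 2 *
    (LINT h|lborel. hessian_kernel i j h * r h * (\<Sum>k\<in>UNIV. \<Sum>l\<in>UNIV. h $ k * h $ l * S k l)) = S i j"
proof -
  let ?N = "real CARD('n)"
  let ?d = "if i = j then 1 else 0 :: real"
  define F where "F k l a b h = (axis k 1 \<bullet> h) * (axis l 1 \<bullet> h) * (axis a 1 \<bullet> h) * (axis b 1 \<bullet> h) / norm h ^ 4 * r h"
    for k l a b and h :: "real^'n"
  define m where "m k l a b = fourth_moment r (axis k 1) (axis l 1) (axis a 1) (axis b (1::real))" for k l a b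
  have iso: "?N * (?N + 2) * fourth_moment r a b c d
     = (a \<bullet> b) * (c \<bullet> d) + (a \<bullet> c) * (b \<bullet> d) + (a \<bullet> d) * (b \<bullet> c)" for a b c d
    by (rule fourth_moment_isotropic[OF r _ mass]) (rule inv)
  have F_int: "integrable lborel (F k l a b)" for k l a b
    unfolding F_def by (rule fourth_moment_integrable[OF r])
  have F_m: "(LINT h|lborel. F k l a b h) = m k l a b" for k l a b
    unfolding F_def m_def fourth_moment_def ..
  have pt: "hessian_kernel i j h * r h * (\<Sum>k\<in>UNIV. \<Sum>l\<in>UNIV. h $ k * h $ l * S k l)
     = (\<Sum>k\<in>UNIV. \<Sum>l\<in>UNIV. S k l * (F k l i j h - ?d / (?N + 2) * (\<Sum>a\<in>UNIV. F k l a a h)))" for h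
  proof -
    have sq: "(norm h)\<^sup>2 = (\<Sum>a\<in>UNIV. h $ a * h $ a)"
      unfolding power2_norm_eq_inner by (simp add: inner_vec_def)
    have Sm: "(\<Sum>a\<in>UNIV. F k l a a h) = h $ k * h $ l * (norm h)\<^sup>2 / norm h ^ 4 * r h" for k l
      unfolding sq F_def by (simp add: inner_axis' sum_distrib_left sum_distrib_right sum_divide_distrib mult.assoc)
    have "S k l * (F k l i j h - ?d / (?N + 2) * (\<Sum>a\<in>UNIV. F k l a a h))
       = hessian_kernel i j h * r h * (h $ k * h $ l * S k l)" for k l
      unfolding Sm by (simp add: F_def hessian_kernel_def inner_axis' diff_divide_distrib algebra_simps)
    then show ?thesis by (simp only: sum_distrib_left)
  qed
  have summand: "S k l * (?N * (?N + 2) * m k l i j - ?d / (?N + 2) * (\<Sum>a\<in>UNIV. ?N * (?N + 2) * m k l a a))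
      = S k l * ((if k = i then if l = j then 1 else 0 else 0) + (if k = j then if l = i then 1 else 0 else 0))" for k l
  proof -
    have mom: "?N * (?N + 2) * m k l a b = (if k = l then 1 else 0) * (if a = b then 1 else 0)
       + (if k = a then 1 else 0) * (if l = b then 1 else 0) + (if k = b then 1 else 0) * (if l = a then 1 else 0)" for a b
      unfolding m_def iso by (simp only: inner_axis_axis inner_real_def mult_1)
    have "(\<Sum>a\<in>UNIV. ?N * (?N + 2) * m k l a a) = (?N + 2) * (if k = l then 1 else 0)"
    proof -
      have "?N * (?N + 2) * m k l a a = (if k = l then 1 else 0) + (if a = k then 2 * (if k = l then 1 else 0) else 0)" for a
        unfolding mom by auto
      then show ?thesis by (simp add: sum.distrib)
    qed
    then have "?d / (?N + 2) * (\<Sum>a\<in>UNIV. ?N * (?N + 2) * m k l a a) = ?d * (if k = l then 1 else 0)"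
      by simp
    then show ?thesis unfolding mom by simp
  qed
  let ?I = "LINT h|lborel. hessian_kernel i j h * r h * (\<Sum>k\<in>UNIV. \<Sum>l\<in>UNIV. h $ k * h $ l * S k l)"
  have "?I = (\<Sum>k\<in>UNIV. \<Sum>l\<in>UNIV. S k l * (m k l i j - ?d / (?N + 2) * (\<Sum>a\<in>UNIV. m k l a a)))"
    unfolding pt by (simp add: F_int F_m)
  then have "?N * (?N + 2) * ?I = ?N * (?N + 2) *
      (\<Sum>k\<in>UNIV. \<Sum>l\<in>UNIV. S k l * (m k l i j - ?d / (?N + 2) * (\<Sum>a\<in>UNIV. m k l a a)))"
    by (simp only:)
  also have "\<dots> = (\<Sum>k\<in>UNIV. \<Sum>l\<in>UNIV.
      S k l * (?N * (?N + 2) * m k l i j - ?d / (?N + 2) * (\<Sum>a\<in>UNIV. ?N * (?N + 2) * m k l a a)))"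
  proof -
    have "?N * (?N + 2) * (S k l * (m k l i j - ?d / (?N + 2) * (\<Sum>a\<in>UNIV. m k l a a)))
       = S k l * (?N * (?N + 2) * m k l i j - ?d / (?N + 2) * (\<Sum>a\<in>UNIV. ?N * (?N + 2) * m k l a a))" for k l
      unfolding sum_distrib_left[symmetric] by (simp only: right_diff_distrib mult_ac)
    then show ?thesis by (simp only: sum_distrib_left[symmetric, where r = "S _ _"] sum_distrib_left[of "?N * (?N + 2)"])
  qed
  also have "\<dots> = (\<Sum>k\<in>UNIV. \<Sum>l\<in>UNIV. S k l * ((if k = i then if l = j then 1 else 0 else 0) + (if k = j then if l = i then 1 else 0 else 0)))"
    by (simp only: summand)
  also have "\<dots> = S i j + S j i"
  proof -
    have 1: "S k l * ((if k = i then if l = j then 1 else 0 else 0) + (if k = j then if l = i then 1 else 0 else 0))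
       = (if k = i then if l = j then S k l else 0 else 0) + (if k = j then if l = i then S k l else 0 else 0)" for k l
      by simp
    have 2: "(\<Sum>l\<in>UNIV. if k = a then if l = b then S k l else 0 else 0) = (if k = a then S a b else 0)" for a b k
      by simp
    show ?thesis unfolding 1 sum.distrib 2 by simp
  qed
  finally show ?thesis using sym[of i j] by (simp add: field_simps)
qed

text \<open>Dominated convergence for the difference quotients, with the Lipschitz constant of \<open>\<psi>\<close> times \<open>\<bar>u\<bar>\<close> as majorant.\<close>
lemma integral_line_derivative:
  fixes u :: "real^'n::finite \<Rightarrow> real"
  assumes u: "integrable lborel u" and \<psi>: "\<psi> \<in> test_functions"
  shows "((\<lambda>t. LINT x|lborel. u x * \<psi> (x + t *\<^sub>R h)) has_real_derivative
     (\<Sum>i\<in>UNIV. h $ i * (LINT x|lborel. u x * partial_deriv i \<psi> (x + t *\<^sub>R h)))) (at t)"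
proof -
  have [measurable]: "u \<in> borel_measurable borel" using u by simp
  have int: "integrable lborel (\<lambda>x. u x * f (x + c))" if f: "f \<in> test_functions" for f c
  proof -
    obtain K where "\<And>x. \<bar>f x\<bar> \<le> K" using test_function_bounded[OF f] by metis
    then show ?thesis
      using test_function_borel[OF test_function_translate[OF f]] by (intro integrable_mult_bounded[OF u]) auto
  qed
  obtain L where L: "\<And>x y. \<bar>\<psi> x - \<psi> y\<bar> \<le> L * norm (x - y)" using test_function_lipschitz[OF \<psi>] by metis
  have [measurable]: "\<psi> \<in> borel_measurable borel" by (rule test_function_borel[OF \<psi>])
  have [measurable]: "partial_deriv i \<psi> \<in> borel_measurable borel" for i
    by (rule test_function_borel[OF test_function_partial_deriv[OF \<psi>]])
  let ?D = "\<lambda>x. \<Sum>i\<in>UNIV. h $ i * partial_deriv i \<psi> (x + t *\<^sub>R h)"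
  let ?q = "\<lambda>s x. (\<psi> (x + s *\<^sub>R h) - \<psi> (x + t *\<^sub>R h)) / (s - t)"
  have lim: "((\<lambda>s. ?q s x) \<longlongrightarrow> ?D x) (at t)" for x
    using test_function_line_derivative[OF \<psi>, of x h t] unfolding has_field_derivative_iff .
  have "((\<lambda>s. LINT x|lborel. u x * ?q s x) \<longlongrightarrow> (LINT x|lborel. u x * ?D x)) (at t)"
    unfolding tendsto_at_iff_sequentially comp_def
  proof (intro allI impI)
    fix X :: "nat \<Rightarrow> real" assume X: "\<forall>n. X n \<in> UNIV - {t}" "X \<longlonglongrightarrow> t"
    show "(\<lambda>n. LINT x|lborel. u x * ?q (X n) x) \<longlonglongrightarrow> (LINT x|lborel. u x * ?D x)"
    proof (rule integral_dominated_convergence)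
      show "integrable lborel (\<lambda>x. \<bar>u x\<bar> * (L * norm h))" using u by simp
      show "AE x in lborel. (\<lambda>n. u x * ?q (X n) x) \<longlonglongrightarrow> u x * ?D x"
        using lim X unfolding tendsto_at_iff_sequentially comp_def by (intro AE_I2 tendsto_mult_left) blast
      have "\<bar>?q (X n) x\<bar> \<le> L * norm h" for n x
      proof -
        have "\<bar>\<psi> (x + X n *\<^sub>R h) - \<psi> (x + t *\<^sub>R h)\<bar> \<le> L * norm ((X n - t) *\<^sub>R h)"
          using L[of "x + X n *\<^sub>R h" "x + t *\<^sub>R h"] by (simp add: scaleR_left_diff_distrib)
        then show ?thesis using X(1) by (simp add: abs_divide divide_le_eq mult_ac)
      qed
      then show "AE x in lborel. norm (u x * ?q (X n) x) \<le> \<bar>u x\<bar> * (L * norm h)" for n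
        unfolding real_norm_def abs_mult by (intro AE_I2 mult_left_mono) auto
    qed measurable
  qed
  moreover have q: "(LINT x|lborel. u x * ?q s x) =
     ((LINT x|lborel. u x * \<psi> (x + s *\<^sub>R h)) - (LINT x|lborel. u x * \<psi> (x + t *\<^sub>R h))) / (s - t)" for s
  proof -
    have "(LINT x|lborel. u x * ?q s x) = (LINT x|lborel. (u x * \<psi> (x + s *\<^sub>R h) - u x * \<psi> (x + t *\<^sub>R h)) / (s - t))"
      by (simp add: right_diff_distrib)
    then show ?thesis using int[OF \<psi>] by simp
  qed
  moreover have D: "(LINT x|lborel. u x * ?D x) = (\<Sum>i\<in>UNIV. h $ i * (LINT x|lborel. u x * partial_deriv i \<psi> (x + t *\<^sub>R h)))"
  proof -
    have "(LINT x|lborel. u x * ?D x) = (LINT x|lborel. (\<Sum>i\<in>UNIV. h $ i * (u x * partial_deriv i \<psi> (x + t *\<^sub>R h))))"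
      by (simp add: sum_distrib_left mult_ac)
    then show ?thesis using int[OF test_function_partial_deriv[OF \<psi>]] by simp
  qed
  ultimately show ?thesis unfolding has_field_derivative_iff by (simp only:)
qed

text \<open>The mean value theorem for \<open>t \<mapsto> F(t) + F(-t) - a t\<^sup>2\<close> on \<open>[0, 1]\<close>, then for \<open>t \<mapsto> F'(t) - a t\<close> on a symmetric interval.\<close>
lemma second_difference_close:
  fixes F :: "real \<Rightarrow> real"
  assumes F: "\<And>t. (F has_real_derivative F' t) (at t)"
    and F': "\<And>t. (F' has_real_derivative F'' t) (at t)"
    and close: "\<And>t. \<bar>t\<bar> \<le> 1 \<Longrightarrow> \<bar>F'' t - a\<bar> \<le> b"
  shows "\<bar>F 1 - 2 * F 0 + F (- 1) - a\<bar> \<le> 2 * b"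
proof -
  define E where "E t = F t + F (- t) - a * t\<^sup>2" for t
  have E: "(E has_real_derivative F' t - F' (- t) - 2 * a * t) (at t)" for t
    unfolding E_def by (auto intro!: derivative_eq_intros F DERIV_chain'[OF _ F])
  from MVT2[OF zero_less_one this]
  obtain s where s: "0 < s" "s < 1" "E 1 - E 0 = F' s - F' (- s) - 2 * a * s" by auto
  have "((\<lambda>t. F' t - a * t) has_real_derivative F'' t - a) (at t)" for t
    by (auto intro!: derivative_eq_intros F')
  from MVT2[of "- s" s, OF _ this] s
  obtain q where q: "- s < q" "q < s" "(F' s - a * s) - (F' (- s) + a * s) = (s - - s) * (F'' q - a)" by auto
  have "\<bar>F'' q - a\<bar> \<le> b" using close[of q] q s by auto
  moreover from this have "0 \<le> b" by linarith
  ultimately have "\<bar>(2 * s) * (F'' q - a)\<bar> \<le> 2 * b"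
    unfolding abs_mult using s by (intro mult_mono) auto
  moreover have "F 1 - 2 * F 0 + F (- 1) - a = (2 * s) * (F'' q - a)"
    using s(3) q(3) by (simp add: E_def)
  ultimately show ?thesis by simp
qed

section \<open>Second differences and the non-local Hessian of a Borel function\<close>

lemma lborel_translation:
  fixes f :: "'a::euclidean_space \<Rightarrow> real"
  assumes [measurable]: "f \<in> borel_measurable borel"
  shows "(LINT x|lborel. f (x + c)) = (LINT x|lborel. f x)"
    and "integrable lborel (\<lambda>x. f (x + c)) \<longleftrightarrow> integrable lborel f"
proof -
  have d: "distr lborel borel (\<lambda>x. x + c) = lborel"
    using lborel_distr_plus[of c] by (simp only: add.commute[of _ c])
  show "(LINT x|lborel. f (x + c)) = (LINT x|lborel. f x)"
    using integral_distr[of "\<lambda>x. x + c" lborel borel f] by (simp add: d)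
  show "integrable lborel (\<lambda>x. f (x + c)) \<longleftrightarrow> integrable lborel f"
    using integrable_distr_eq[of "\<lambda>x. x + c" lborel borel f] by (simp add: d)
qed

lemma zero_test_function: "(\<lambda>x::real^'n::finite. 0) \<in> test_functions"
proof -
  have "C_k k (\<lambda>x::real^'n. 0)" for k
    using C_k_bump_polynomial[OF real_polynomial_function.intros(2)[of 0], of k 0 0] by simp
  then show ?thesis by (simp add: test_functions_def)
qed

definition second_difference :: "('a::real_normed_vector \<Rightarrow> real) \<Rightarrow> 'a \<Rightarrow> 'a \<Rightarrow> real" where
  "second_difference u h x = u (x + h) - 2 * u x + u (x - h)"

text \<open>What the argument needs of \<open>u \<in> BV\<^sup>2\<close> and of its Hessian measure: the pairing of the second distributional derivative with
  test functions is Lipschitz in the supremum norm. The constant is written as \<open>K / (2 N\<^sup>2)\<close> so that \<open>K\<close> itself is the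
  constant in the bound for second differences.\<close>
locale weak_hessian =
  fixes u :: "real^'n::finite \<Rightarrow> real" and K :: real
  assumes u: "integrable lborel u" and K: "0 \<le> K"
    and lipschitz: "\<And>\<psi> \<psi>' i j e. \<psi> \<in> test_functions \<Longrightarrow> \<psi>' \<in> test_functions \<Longrightarrow> (\<And>x. \<bar>\<psi> x - \<psi>' x\<bar> \<le> e) \<Longrightarrow>
      \<bar>(LINT x|lborel. u x * partial_deriv i (partial_deriv j \<psi>) x)
        - (LINT x|lborel. u x * partial_deriv i (partial_deriv j \<psi>') x)\<bar> \<le> K / (2 * (real CARD('n))\<^sup>2) * e"
begin

lemma u_measurable [measurable]: "u \<in> borel_measurable borel"
  using u by simp

definition hess :: "'n \<Rightarrow> 'n \<Rightarrow> (real^'n \<Rightarrow> real) \<Rightarrow> real" where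
  "hess i j \<psi> = (LINT x|lborel. u x * partial_deriv i (partial_deriv j \<psi>) x)"

lemma hess_sym: "\<psi> \<in> test_functions \<Longrightarrow> hess i j \<psi> = hess j i \<psi>"
  unfolding hess_def using test_function_mixed_partials_commute by metis

lemma hess_zero: "hess i j (\<lambda>x. 0) = 0"
proof -
  have "partial_deriv i (\<lambda>x::real^'n. 0) = (\<lambda>x. 0)" for i
    using partial_deriv_eq[OF has_derivative_const] by blast
  then show ?thesis by (simp add: hess_def)
qed

lemma integrable_second_difference: "integrable lborel (second_difference u h)"
proof -
  have "integrable lborel (\<lambda>x. u (x + h))" "integrable lborel (\<lambda>x. u (x - h))"
    using u lborel_translation(2)[of u h] lborel_translation(2)[of u "- h"] by simp_all
  then show ?thesis unfolding second_difference_def[abs_def] using u by simp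
qed

text \<open>The second difference of \<open>u\<close> paired with \<open>\<psi>\<close> is the second difference at \<open>0\<close> of
  \<open>F(t) = \<integral> u(x) \<psi>(x + t h) dx\<close>, whose second derivative is the pairing of \<open>D\<^sup>2u\<close> with a translate of \<open>\<psi>\<close>. Taking \<open>\<psi>0 = \<psi>\<close> gives
  the expansion for small \<open>h\<close>, and \<open>\<psi>0 = 0\<close> gives a bound by the supremum of \<open>\<bar>\<psi>\<bar>\<close>.\<close>
lemma second_difference_estimate:
  assumes \<psi>: "\<psi> \<in> test_functions" and \<psi>0: "\<psi>0 \<in> test_functions"
    and close: "\<And>t x. \<bar>t\<bar> \<le> 1 \<Longrightarrow> \<bar>\<psi> (x + t *\<^sub>R h) - \<psi>0 x\<bar> \<le> e"
  shows "\<bar>(LINT x|lborel. second_difference u h x * \<psi> x) - (\<Sum>k\<in>UNIV. \<Sum>l\<in>UNIV. h $ k * h $ l * hess k l \<psi>0)\<bar>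
     \<le> K * (norm h)\<^sup>2 * e"
proof -
  let ?C = "K / (2 * (real CARD('n))\<^sup>2)"
  define F where "F f t = (LINT x|lborel. u x * f (x + t *\<^sub>R h))" for f :: "real^'n \<Rightarrow> real" and t
  have F: "(F f has_real_derivative (\<Sum>i\<in>UNIV. h $ i * F (partial_deriv i f) t)) (at t)"
    if "f \<in> test_functions" for f t
    using integral_line_derivative[OF u that] unfolding F_def .
  have F': "((\<lambda>t. \<Sum>i\<in>UNIV. h $ i * F (partial_deriv i \<psi>) t) has_real_derivative
      (\<Sum>l\<in>UNIV. h $ l * (\<Sum>k\<in>UNIV. h $ k * F (partial_deriv k (partial_deriv l \<psi>)) t))) (at t)" for t
    by (intro DERIV_sum DERIV_cmult F test_function_partial_deriv \<psi>)
  have F_S: "F (partial_deriv k (partial_deriv l \<psi>)) t = hess k l (\<lambda>x. \<psi> (x + t *\<^sub>R h))" for k l t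
  proof -
    have "partial_deriv l (\<lambda>x. \<psi> (x + t *\<^sub>R h)) = (\<lambda>x. partial_deriv l \<psi> (x + t *\<^sub>R h))"
      using differentiable_translate(2)[OF test_function_differentiable[OF \<psi>]] by blast
    moreover have "partial_deriv k (\<lambda>x. partial_deriv l \<psi> (x + t *\<^sub>R h)) = (\<lambda>x. partial_deriv k (partial_deriv l \<psi>) (x + t *\<^sub>R h))"
      using differentiable_translate(2)[OF test_function_differentiable[OF test_function_partial_deriv[OF \<psi>]]] by blast
    ultimately show ?thesis by (simp add: F_def hess_def)
  qed
  let ?a = "\<Sum>l\<in>UNIV. h $ l * (\<Sum>k\<in>UNIV. h $ k * hess k l \<psi>0)"
  have "\<bar>F \<psi> 1 - 2 * F \<psi> 0 + F \<psi> (- 1) - ?a\<bar> \<le> 2 * (K / 2 * (norm h)\<^sup>2 * e)"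
  proof (rule second_difference_close[OF F[OF \<psi>] F'])
    fix t :: real assume t: "\<bar>t\<bar> \<le> 1"
    have e: "0 \<le> e" using close[OF t, of 0] by linarith
    have "(\<Sum>l\<in>UNIV. h $ l * (\<Sum>k\<in>UNIV. h $ k * F (partial_deriv k (partial_deriv l \<psi>)) t)) - ?a
      = (\<Sum>l\<in>UNIV. \<Sum>k\<in>UNIV. h $ l * h $ k * (hess k l (\<lambda>x. \<psi> (x + t *\<^sub>R h)) - hess k l \<psi>0))"
      unfolding F_S by (simp add: sum_distrib_left right_diff_distrib sum_subtractf mult.assoc)
    also have "\<bar>\<dots>\<bar> \<le> (\<Sum>l\<in>(UNIV::'n set). \<Sum>k\<in>(UNIV::'n set). norm h * norm h * (?C * e))"
    proof (intro order_trans[OF sum_abs] sum_mono)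
      fix l k
      have "\<bar>hess k l (\<lambda>x. \<psi> (x + t *\<^sub>R h)) - hess k l \<psi>0\<bar> \<le> ?C * e"
        unfolding hess_def by (rule lipschitz[OF test_function_translate[OF \<psi>] \<psi>0 close[OF t]])
      then show "\<bar>h $ l * h $ k * (hess k l (\<lambda>x. \<psi> (x + t *\<^sub>R h)) - hess k l \<psi>0)\<bar> \<le> norm h * norm h * (?C * e)"
        unfolding abs_mult by (intro mult_mono component_le_norm_cart) (auto simp: K e)
    qed
    also have "\<dots> = K / 2 * (norm h)\<^sup>2 * e" by (simp add: power2_eq_square field_simps)
    finally show "\<bar>(\<Sum>l\<in>UNIV. h $ l * (\<Sum>k\<in>UNIV. h $ k * F (partial_deriv k (partial_deriv l \<psi>)) t)) - ?a\<bar>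
      \<le> K / 2 * (norm h)\<^sup>2 * e" .
  qed
  moreover have "?a = (\<Sum>k\<in>UNIV. \<Sum>l\<in>UNIV. h $ k * h $ l * hess k l \<psi>0)"
    unfolding sum_distrib_left by (subst sum.swap) (simp add: mult_ac)
  moreover have "(LINT x|lborel. second_difference u h x * \<psi> x) = F \<psi> 1 - 2 * F \<psi> 0 + F \<psi> (- 1)"
  proof -
    note [measurable] = test_function_borel[OF \<psi>]
    obtain B where B: "\<And>x. \<bar>\<psi> x\<bar> \<le> B" using test_function_bounded[OF \<psi>] by metis
    have i: "integrable lborel (\<lambda>x. u x * \<psi> (x + c))" for c
      by (rule integrable_mult_bounded[OF u _ B]) measurable
    have s: "(LINT x|lborel. u (x + c) * \<psi> x) = (LINT x|lborel. u x * \<psi> (x - c))"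
        "integrable lborel (\<lambda>x. u (x + c) * \<psi> x)" for c
    proof -
      have [measurable]: "(\<lambda>x. u x * \<psi> (x - c)) \<in> borel_measurable borel" by measurable
      show "(LINT x|lborel. u (x + c) * \<psi> x) = (LINT x|lborel. u x * \<psi> (x - c))"
        using lborel_translation(1)[of "\<lambda>x. u x * \<psi> (x - c)" c] by simp
      show "integrable lborel (\<lambda>x. u (x + c) * \<psi> x)"
        using lborel_translation(2)[of "\<lambda>x. u x * \<psi> (x - c)" c] i[of "- c"] by simp
    qed
    have "(LINT x|lborel. second_difference u h x * \<psi> x) =
      (LINT x|lborel. u (x + h) * \<psi> x - 2 * (u x * \<psi> (x + 0)) + u (x + - h) * \<psi> x)"
      unfolding second_difference_def by (simp add: algebra_simps)
    also have "\<dots> = (LINT x|lborel. u (x + h) * \<psi> x) - 2 * (LINT x|lborel. u x * \<psi> (x + 0)) + (LINT x|lborel. u (x + - h) * \<psi> x)"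
      using s(2)[of h] s(2)[of "- h"] i[of 0] by simp
    finally show ?thesis unfolding s F_def by simp
  qed
  ultimately show ?thesis by (simp add: mult.assoc)
qed

lemma L1_second_difference: "(LINT x|lborel. \<bar>second_difference u h x\<bar>) \<le> K * (norm h)\<^sup>2"
proof (rule integral_abs_le_test_functions[OF integrable_second_difference])
  fix \<psi> :: "real^'n \<Rightarrow> real" and B assume "\<psi> \<in> test_functions" "\<And>x. \<bar>\<psi> x\<bar> \<le> B"
  then have "\<bar>(LINT x|lborel. second_difference u h x * \<psi> x)\<bar> \<le> K * (norm h)\<^sup>2 * B"
    using second_difference_estimate[OF _ zero_test_function, of \<psi> h B] by (simp add: hess_zero)
  then show "(LINT x|lborel. second_difference u h x * \<psi> x) \<le> K * (norm h)\<^sup>2 * B" by linarith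
qed

end

text \<open>Here \<open>r\<close> stands for a Borel representative of one of the densities \<open>\<rho>\<^sub>n\<close>.\<close>
locale weak_hessian_mollified = weak_hessian u K
  for u :: "real^'n::finite \<Rightarrow> real" and K :: real +
  fixes r :: "real^'n \<Rightarrow> real"
  assumes r: "integrable lborel r" and r_nonneg: "\<And>h. 0 \<le> r h" and r_mass: "(LINT h|lborel. r h) = 1"
begin

lemma r_measurable [measurable]: "r \<in> borel_measurable borel"
  using r by simp

definition nonlocal_term :: "'n \<Rightarrow> 'n \<Rightarrow> real^'n \<Rightarrow> real^'n \<Rightarrow> real" where
  "nonlocal_term i j h x = second_difference u h x * (hessian_kernel i j h * r h)"

lemma nonlocal_term_measurable: "case_prod (nonlocal_term i j) \<in> borel_measurable (lborel \<Otimes>\<^sub>M lborel)"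
  unfolding nonlocal_term_def[abs_def] second_difference_def[abs_def] by measurable

text \<open>The factor \<open>\<parallel>h\<parallel>\<^sup>2\<close> in the bound for the second difference absorbs the singularity of the kernel.\<close>
lemma nonlocal_term_L1: "(LINT x|lborel. \<bar>nonlocal_term i j h x\<bar>) \<le> 2 * K * r h"
proof -
  have "(LINT x|lborel. \<bar>nonlocal_term i j h x\<bar>) = (LINT x|lborel. \<bar>second_difference u h x\<bar> * (\<bar>hessian_kernel i j h\<bar> * r h))"
    by (simp add: nonlocal_term_def abs_mult r_nonneg)
  also have "\<dots> = (LINT x|lborel. \<bar>second_difference u h x\<bar>) * (\<bar>hessian_kernel i j h\<bar> * r h)"
    by simp
  also have "\<dots> \<le> K * (norm h)\<^sup>2 * (\<bar>hessian_kernel i j h\<bar> * r h)"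
    by (intro mult_right_mono L1_second_difference) (simp add: r_nonneg)
  also have "\<dots> = K * r h * (\<bar>hessian_kernel i j h\<bar> * (norm h)\<^sup>2)" by (simp only: mult_ac)
  also have "\<dots> \<le> K * r h * 2"
    by (intro mult_left_mono hessian_kernel_bound) (simp add: r_nonneg K)
  finally show ?thesis by (simp add: mult_ac)
qed

lemma nonlocal_term_integrable: "integrable (lborel \<Otimes>\<^sub>M lborel) (case_prod (nonlocal_term i j))"
proof (rule lborel_pair.Fubini_integrable[OF nonlocal_term_measurable])
  have m: "(\<lambda>h. LINT x|lborel. \<bar>nonlocal_term i j h x\<bar>) \<in> borel_measurable lborel"
    using nonlocal_term_measurable[of i j] by measurable
  show "integrable lborel (\<lambda>h. LINT x|lborel. norm (case (h, x) of (h, x) \<Rightarrow> nonlocal_term i j h x))"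
  proof (rule Bochner_Integration.integrable_bound)
    show "integrable lborel (\<lambda>h. 2 * K * r h)" using r by simp
    show "(\<lambda>h. LINT x|lborel. norm (case (h, x) of (h, x) \<Rightarrow> nonlocal_term i j h x)) \<in> borel_measurable lborel"
      using m by simp
    have "norm (LINT x|lborel. \<bar>nonlocal_term i j h x\<bar>) \<le> norm (2 * K * r h)" for h
      using nonlocal_term_L1[of i j h] integral_nonneg_AE[of "\<lambda>x. \<bar>nonlocal_term i j h x\<bar>" lborel] by (simp add: abs_of_nonneg)
    then show "AE h in lborel. norm (LINT x|lborel. norm (case (h, x) of (h, x) \<Rightarrow> nonlocal_term i j h x)) \<le> norm (2 * K * r h)"
      by simp
  qed
  show "AE h in lborel. integrable lborel (\<lambda>x. case (h, x) of (h, x) \<Rightarrow> nonlocal_term i j h x)"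
    unfolding nonlocal_term_def prod.case using integrable_second_difference by simp
qed

definition nonlocal_entry :: "'n \<Rightarrow> 'n \<Rightarrow> real^'n \<Rightarrow> real" where
  "nonlocal_entry i j x = real CARD('n) * (real CARD('n) + 2) / 2 * (LINT h|lborel. nonlocal_term i j h x)"

lemma nonlocal_entry_integrable: "integrable lborel (nonlocal_entry i j)"
  unfolding nonlocal_entry_def[abs_def] using lborel_pair.integrable_snd[OF nonlocal_term_integrable] by simp

lemma nonlocal_term_AE_integrable: "AE x in lborel. integrable lborel (\<lambda>h. nonlocal_term i j h x)"
  by (rule lborel_pair.AE_integrable_snd[OF nonlocal_term_integrable])

lemma nonlocal_entry_L1: "(LINT x|lborel. \<bar>nonlocal_entry i j x\<bar>) \<le> real CARD('n) * (real CARD('n) + 2) / 2 * (2 * K)"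
proof -
  have abs: "integrable (lborel \<Otimes>\<^sub>M lborel) (case_prod (\<lambda>h x. \<bar>nonlocal_term i j h x\<bar>))"
    using integrable_abs[OF nonlocal_term_integrable[of i j]] by (simp add: case_prod_beta')
  have "(LINT x|lborel. \<bar>LINT h|lborel. nonlocal_term i j h x\<bar>) \<le> (LINT x|lborel. (LINT h|lborel. \<bar>nonlocal_term i j h x\<bar>))"
    by (intro integral_mono integral_abs_bound integrable_abs lborel_pair.integrable_snd nonlocal_term_integrable abs)
  also have "\<dots> = (LINT h|lborel. (LINT x|lborel. \<bar>nonlocal_term i j h x\<bar>))"
    by (rule lborel_pair.Fubini_integral[OF abs])
  also have "\<dots> \<le> (LINT h|lborel. 2 * K * r h)"
    by (intro integral_mono lborel_pair.integrable_fst abs nonlocal_term_L1) (use r in simp)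
  also have "\<dots> = 2 * K" using r_mass by simp
  finally have "(LINT x|lborel. \<bar>LINT h|lborel. nonlocal_term i j h x\<bar>) \<le> 2 * K" .
  then show ?thesis unfolding nonlocal_entry_def abs_mult by (simp add: mult_left_mono)
qed

text \<open>After Fubini, the quadratic part of the pairing with \<open>\<psi>\<close> reproduces \<open>hess i j \<psi>\<close> exactly. The remainder is controlled by the oscillation of
  \<open>\<psi>\<close> over distance \<open>\<parallel>h\<parallel>\<close>: at most \<open>L \<gamma>\<close> where \<open>\<parallel>h\<parallel> \<le> \<gamma>\<close>, and at most \<open>2 B\<close> elsewhere, a region of small mass.\<close>
lemma nonlocal_entry_test_function_estimate:
  assumes inv: "\<And>T. orthogonal_transformation T \<Longrightarrow> AE h in lborel. r (T h) = r h"
    and \<psi>: "\<psi> \<in> test_functions" and B: "\<And>x. \<bar>\<psi> x\<bar> \<le> B"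
    and L: "0 \<le> L" "\<And>x y. \<bar>\<psi> x - \<psi> y\<bar> \<le> L * norm (x - y)" and \<gamma>: "\<gamma> > 0"
  shows "\<bar>(LINT x|lborel. nonlocal_entry i j x * \<psi> x) - hess i j \<psi>\<bar>
     \<le> real CARD('n) * (real CARD('n) + 2) / 2 * (2 * K) * (L * \<gamma> + 2 * B * (LINT h|lborel. indicator {h. norm h > \<gamma>} h * r h))"
proof -
  let ?c = "real CARD('n) * (real CARD('n) + 2) / 2"
  let ?G = "\<lambda>h. LINT x|lborel. second_difference u h x * \<psi> x"
  let ?Q = "\<lambda>h. \<Sum>k\<in>UNIV. \<Sum>l\<in>UNIV. h $ k * h $ l * hess k l \<psi>"
  let ?k = "hessian_kernel i j"
  let ?e = "\<lambda>h. L * \<gamma> + 2 * B * indicator {h. norm h > \<gamma>} h"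
  note [measurable] = test_function_borel[OF \<psi>]
  have B0: "0 \<le> B" using B[of 0] by linarith
  have Q_meas[measurable]: "?Q \<in> borel_measurable borel" by measurable
  have nonlocal_term\<psi>: "integrable (lborel \<Otimes>\<^sub>M lborel) (case_prod (\<lambda>h x. nonlocal_term i j h x * \<psi> x))"
  proof -
    have "integrable (lborel \<Otimes>\<^sub>M lborel) (\<lambda>p. case_prod (nonlocal_term i j) p * \<psi> (snd p))"
      by (rule integrable_mult_bounded[OF nonlocal_term_integrable _ B]) measurable
    then show ?thesis by (simp add: case_prod_beta')
  qed
  have G_eq: "(LINT x|lborel. nonlocal_term i j h x * \<psi> x) = ?k h * r h * ?G h" for h
  proof -
    have "(LINT x|lborel. nonlocal_term i j h x * \<psi> x) = (LINT x|lborel. ?k h * r h * (second_difference u h x * \<psi> x))"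
      unfolding nonlocal_term_def by (simp add: mult_ac)
    then show ?thesis by simp
  qed
  have G_int: "integrable lborel (\<lambda>h. ?k h * r h * ?G h)"
    using lborel_pair.integrable_fst[OF nonlocal_term\<psi>] unfolding G_eq .
  have Q_int: "integrable lborel (\<lambda>h. ?k h * r h * ?Q h)"
  proof (rule Bochner_Integration.integrable_bound)
    let ?M = "\<Sum>k\<in>UNIV. \<Sum>l\<in>UNIV. \<bar>hess k l \<psi>\<bar>"
    show "integrable lborel (\<lambda>h. 2 * ?M * r h)" using r by simp
    have "\<bar>?k h * r h * ?Q h\<bar> \<le> 2 * ?M * r h" for h
    proof -
      have "\<bar>?Q h\<bar> \<le> (\<Sum>k\<in>UNIV. \<Sum>l\<in>UNIV. norm h * norm h * \<bar>hess k l \<psi>\<bar>)"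
      proof (rule order_trans[OF sum_abs], rule sum_mono, rule order_trans[OF sum_abs], rule sum_mono)
        show "\<bar>h $ k * h $ l * hess k l \<psi>\<bar> \<le> norm h * norm h * \<bar>hess k l \<psi>\<bar>" for k l
          unfolding abs_mult by (intro mult_mono component_le_norm_cart) auto
      qed
      then have Q: "\<bar>?Q h\<bar> \<le> (norm h)\<^sup>2 * ?M" by (simp add: sum_distrib_left power2_eq_square)
      have "\<bar>?k h * r h * ?Q h\<bar> \<le> \<bar>?k h\<bar> * r h * ((norm h)\<^sup>2 * ?M)"
        unfolding abs_mult using r_nonneg[of h] by (intro mult_mono Q) auto
      also have "\<dots> = \<bar>?k h\<bar> * (norm h)\<^sup>2 * (?M * r h)" by (simp only: mult_ac)
      also have "\<dots> \<le> 2 * (?M * r h)"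
        by (intro mult_right_mono hessian_kernel_bound mult_nonneg_nonneg sum_nonneg r_nonneg) auto
      finally show ?thesis by (simp only: mult_ac)
    qed
    then show "AE h in lborel. norm (?k h * r h * ?Q h) \<le> norm (2 * ?M * r h)"
      unfolding real_norm_def by (intro AE_I2 order_trans[OF _ abs_ge_self])
  qed measurable
  have "(LINT x|lborel. nonlocal_entry i j x * \<psi> x) = ?c * (LINT x|lborel. (LINT h|lborel. nonlocal_term i j h x * \<psi> x))"
    unfolding nonlocal_entry_def by (simp add: mult.assoc)
  also have "(LINT x|lborel. (LINT h|lborel. nonlocal_term i j h x * \<psi> x)) = (LINT h|lborel. ?k h * r h * ?G h)"
    unfolding lborel_pair.Fubini_integral[OF nonlocal_term\<psi>] G_eq ..
  finally have Hc: "(LINT x|lborel. nonlocal_entry i j x * \<psi> x) = ?c * (LINT h|lborel. ?k h * r h * ?G h)" .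
  have Sc: "hess i j \<psi> = ?c * (LINT h|lborel. ?k h * r h * ?Q h)"
    by (rule hessian_kernel_quadratic_form[where S = "\<lambda>k l. hess k l \<psi>", symmetric])
      (rule r, rule inv, assumption, rule r_mass, rule hess_sym[OF \<psi>])
  have diff: "(LINT x|lborel. nonlocal_entry i j x * \<psi> x) - hess i j \<psi> = ?c * (LINT h|lborel. ?k h * r h * ?G h - ?k h * r h * ?Q h)"
    unfolding Hc Sc Bochner_Integration.integral_diff[OF G_int Q_int] by (simp only: right_diff_distrib)
  have bound: "\<bar>(LINT x|lborel. nonlocal_entry i j x * \<psi> x) - hess i j \<psi>\<bar> \<le> ?c * (LINT h|lborel. 2 * K * (r h * ?e h))"
  proof -
    have pt: "\<bar>?k h * r h * ?G h - ?k h * r h * ?Q h\<bar> \<le> 2 * K * (r h * ?e h)" for h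
    proof -
      have e: "0 \<le> ?e h" using L(1) \<gamma> B0 by simp
      \<comment> \<open>both summands of \<open>?e h\<close> are nonnegative, so each case needs only one of them\<close>
      have close: "\<bar>\<psi> (x + t *\<^sub>R h) - \<psi> x\<bar> \<le> ?e h" if t: "\<bar>t\<bar> \<le> 1" for t x
      proof (cases "norm h > \<gamma>")
        case True
        have "0 \<le> L * \<gamma>" using L(1) \<gamma> by simp
        then show ?thesis using True B[of "x + t *\<^sub>R h"] B[of x] by simp
      next
        case False
        have "\<bar>\<psi> (x + t *\<^sub>R h) - \<psi> x\<bar> \<le> L * norm (t *\<^sub>R h)" using L(2)[of "x + t *\<^sub>R h" x] by simp
        also have "\<dots> \<le> L * (1 * \<gamma>)"
          unfolding norm_scaleR using False t L(1) by (intro mult_left_mono mult_mono) auto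
        finally show ?thesis using False by simp
      qed
      have "\<bar>?k h * r h * ?G h - ?k h * r h * ?Q h\<bar> = \<bar>?k h\<bar> * r h * \<bar>?G h - ?Q h\<bar>"
        unfolding right_diff_distrib[symmetric] abs_mult using r_nonneg[of h] by simp
      also have "\<dots> \<le> \<bar>?k h\<bar> * r h * (K * (norm h)\<^sup>2 * ?e h)"
        by (intro mult_left_mono second_difference_estimate[OF \<psi> \<psi>] close mult_nonneg_nonneg r_nonneg) auto
      also have "\<dots> = \<bar>?k h\<bar> * (norm h)\<^sup>2 * (K * (r h * ?e h))" by (simp only: mult_ac)
      also have "\<dots> \<le> 2 * (K * (r h * ?e h))"
        using K by (intro mult_right_mono hessian_kernel_bound mult_nonneg_nonneg r_nonneg e) auto
      finally show ?thesis by (simp only: mult.assoc)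
    qed
    have "integrable lborel (\<lambda>h. r h * ?e h)"
    proof (rule integrable_mult_bounded[OF r])
      show "?e \<in> borel_measurable lborel" by measurable
      show "\<bar>?e h\<bar> \<le> L * \<gamma> + 2 * B" for h
        using L(1) \<gamma> B0 by (auto simp: indicator_def abs_of_nonneg)
    qed
    then have ri: "integrable lborel (\<lambda>h. 2 * K * (r h * ?e h))" by simp
    have "\<bar>LINT h|lborel. ?k h * r h * ?G h - ?k h * r h * ?Q h\<bar> \<le> (LINT h|lborel. \<bar>?k h * r h * ?G h - ?k h * r h * ?Q h\<bar>)"
      by (rule integral_abs_bound)
    also have "\<dots> \<le> (LINT h|lborel. 2 * K * (r h * ?e h))"
      by (intro integral_mono ri pt integrable_abs Bochner_Integration.integrable_diff G_int Q_int)
    finally show ?thesis unfolding diff abs_mult by (intro mult_mono) auto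
  qed
  have "(LINT h|lborel. 2 * K * (r h * ?e h)) = 2 * K * (L * \<gamma> + 2 * B * (LINT h|lborel. indicator {h. norm h > \<gamma>} h * r h))"
  proof -
    have i: "integrable lborel (\<lambda>h. indicator {h. norm h > \<gamma>} h * r h)"
      using integrable_mult_bounded[OF r, of "indicator {h. norm h > \<gamma>}" 1]
      by (simp add: mult.commute indicator_def)
    have "(LINT h|lborel. r h * ?e h) = (LINT h|lborel. L * \<gamma> * r h + 2 * B * (indicator {h. norm h > \<gamma>} h * r h))"
      by (simp add: algebra_simps)
    also have "\<dots> = L * \<gamma> + 2 * B * (LINT h|lborel. indicator {h. norm h > \<gamma>} h * r h)"
      using r i r_mass by simp
    finally show ?thesis by simp
  qed
  with bound show ?thesis by (simp only: mult.assoc)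
qed

end

text \<open>Approximate \<open>f\<close> by a test function \<open>\<psi>\<close>, compare the integrals by the uniform \<open>L\<^sup>1\<close> bound and the limits by
  the hypothesis on \<open>l\<close>, and choose \<open>\<gamma>\<close> so small that the oscillation of \<open>\<psi>\<close> over distance \<open>\<gamma>\<close> is negligible
  before letting \<open>n\<close> grow.\<close>
lemma (in weak_hessian) nonlocal_hessian_converges:
  fixes r :: "nat \<Rightarrow> real^'n \<Rightarrow> real"
  assumes moll: "\<And>n. weak_hessian_mollified u K (r n)"
    and inv: "\<And>n T. orthogonal_transformation T \<Longrightarrow> AE h in lborel. r n (T h) = r n h"
    and conc: "\<And>\<gamma>. \<gamma> > 0 \<Longrightarrow> (\<lambda>n. LINT h|lborel. indicator {h. norm h > \<gamma>} h * r n h) \<longlonglongrightarrow> 0"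
    and f: "continuous_on UNIV f" "(f \<longlongrightarrow> 0) at_infinity"
    and C: "0 \<le> C"
    and l: "\<And>\<psi> e. \<psi> \<in> test_functions \<Longrightarrow> (\<And>x. \<bar>\<psi> x - f x\<bar> \<le> e) \<Longrightarrow> \<bar>hess i j \<psi> - l\<bar> \<le> C * e"
  shows "(\<lambda>n. LINT x|lborel. weak_hessian_mollified.nonlocal_entry u (r n) i j x * f x) \<longlonglongrightarrow> l"
proof (rule LIMSEQ_I)
  fix \<eta> :: real assume \<eta>: "\<eta> > 0"
  define A where "A = real CARD('n) * (real CARD('n) + 2) / 2 * (2 * K)"
  have A: "0 \<le> A" using K by (simp add: A_def)
  \<comment> \<open>the errors below add up to \<open>(3 A + C) e\<close>\<close>
  define e where "e = \<eta> / (3 * A + C + 1)"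
  have e: "e > 0" using \<eta> A C by (simp add: e_def)
  obtain \<psi> where \<psi>: "\<psi> \<in> test_functions" "\<And>x. \<bar>\<psi> x - f x\<bar> \<le> e"
    using test_functions_dense_C0[OF f e] by metis
  obtain B where B: "0 \<le> B" "\<And>x. \<bar>\<psi> x\<bar> \<le> B" using test_function_bounded[OF \<psi>(1)] by metis
  obtain L where L: "0 \<le> L" "\<And>x y. \<bar>\<psi> x - \<psi> y\<bar> \<le> L * norm (x - y)" using test_function_lipschitz[OF \<psi>(1)] by metis
  define \<gamma> where "\<gamma> = e / (L + 1)"
  have \<gamma>: "\<gamma> > 0" "L * \<gamma> \<le> e" using e L(1) by (auto simp: \<gamma>_def field_simps)
  have "e / (2 * B + 1) > 0" using e B(1) by simp
  from LIMSEQ_D[OF conc[OF \<gamma>(1)] this] obtain n0 where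
    n0: "\<And>n. n \<ge> n0 \<Longrightarrow> \<bar>LINT h|lborel. indicator {h. norm h > \<gamma>} h * r n h\<bar> < e / (2 * B + 1)"
    by auto
  show "\<exists>n0. \<forall>n\<ge>n0. norm ((LINT x|lborel. weak_hessian_mollified.nonlocal_entry u (r n) i j x * f x) - l) < \<eta>"
  proof (intro exI allI impI)
    fix n assume n: "n \<ge> n0"
    interpret m: weak_hessian_mollified u K "r n" by (rule moll)
    have fm: "f \<in> borel_measurable lborel" using borel_measurable_continuous_onI[OF f(1)] by simp
    have \<psi>m: "\<psi> \<in> borel_measurable lborel" using test_function_borel[OF \<psi>(1)] by simp
    have fB: "\<bar>f x\<bar> \<le> B + e" for x using B(2)[of x] \<psi>(2)[of x] by linarith
    have i: "integrable lborel (\<lambda>x. m.nonlocal_entry i j x * f x)" "integrable lborel (\<lambda>x. m.nonlocal_entry i j x * \<psi> x)"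
      by (rule integrable_mult_bounded[OF m.nonlocal_entry_integrable fm fB], rule integrable_mult_bounded[OF m.nonlocal_entry_integrable \<psi>m B(2)])
    have 1: "\<bar>(LINT x|lborel. m.nonlocal_entry i j x * f x) - (LINT x|lborel. m.nonlocal_entry i j x * \<psi> x)\<bar> \<le> A * e"
    proof -
      have "(LINT x|lborel. m.nonlocal_entry i j x * f x) - (LINT x|lborel. m.nonlocal_entry i j x * \<psi> x) = (LINT x|lborel. m.nonlocal_entry i j x * f x - m.nonlocal_entry i j x * \<psi> x)"
        using i by simp
      also have "\<bar>\<dots>\<bar> \<le> (LINT x|lborel. \<bar>m.nonlocal_entry i j x * f x - m.nonlocal_entry i j x * \<psi> x\<bar>)" by (rule integral_abs_bound)
      also have "\<dots> \<le> (LINT x|lborel. \<bar>m.nonlocal_entry i j x\<bar> * e)"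
      proof (rule integral_mono)
        show "integrable lborel (\<lambda>x. \<bar>m.nonlocal_entry i j x * f x - m.nonlocal_entry i j x * \<psi> x\<bar>)" using i by simp
        show "integrable lborel (\<lambda>x. \<bar>m.nonlocal_entry i j x\<bar> * e)" using m.nonlocal_entry_integrable by simp
        show "\<bar>m.nonlocal_entry i j x * f x - m.nonlocal_entry i j x * \<psi> x\<bar> \<le> \<bar>m.nonlocal_entry i j x\<bar> * e" for x
          unfolding right_diff_distrib[symmetric] abs_mult using \<psi>(2)[of x]
          by (intro mult_left_mono) (auto simp: abs_minus_commute)
      qed
      also have "\<dots> = (LINT x|lborel. \<bar>m.nonlocal_entry i j x\<bar>) * e" by simp
      also have "\<dots> \<le> A * e" unfolding A_def using e by (intro mult_right_mono m.nonlocal_entry_L1) auto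
      finally show ?thesis .
    qed
    have "\<bar>(LINT x|lborel. m.nonlocal_entry i j x * \<psi> x) - hess i j \<psi>\<bar>
      \<le> A * (L * \<gamma> + 2 * B * (LINT h|lborel. indicator {h. norm h > \<gamma>} h * r n h))"
      unfolding A_def by (rule m.nonlocal_entry_test_function_estimate[OF inv \<psi>(1) B(2) L \<gamma>(1)])
    also have "\<dots> \<le> A * (e + e)"
    proof (intro mult_left_mono add_mono \<gamma>(2) A)
      have "2 * B * (LINT h|lborel. indicator {h. norm h > \<gamma>} h * r n h) \<le> 2 * B * (e / (2 * B + 1))"
        using n0[OF n] B(1) by (intro mult_left_mono) auto
      also have "\<dots> \<le> e" using B(1) e by (simp add: field_simps)
      finally show "2 * B * (LINT h|lborel. indicator {h. norm h > \<gamma>} h * r n h) \<le> e" .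
    qed
    finally have 2: "\<bar>(LINT x|lborel. m.nonlocal_entry i j x * \<psi> x) - hess i j \<psi>\<bar> \<le> A * (e + e)" .
    have 3: "\<bar>hess i j \<psi> - l\<bar> \<le> C * e" by (rule l[OF \<psi>])
    have "\<bar>(LINT x|lborel. m.nonlocal_entry i j x * f x) - l\<bar> \<le> A * e + A * (e + e) + C * e"
      using 1 2 3 by linarith
    also have "\<dots> = (3 * A + C) * e" by (simp add: algebra_simps)
    also have "\<dots> < (3 * A + C + 1) * e" using e by (intro mult_strict_right_mono) auto
    also have "\<dots> = \<eta>" using A C by (simp add: e_def)
    finally show "norm ((LINT x|lborel. m.nonlocal_entry i j x * f x) - l) < \<eta>" by simp
  qed
qed

section \<open>Lebesgue measurable data and weak-star convergence\<close>

lemma AE_lborel_invariant: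
  fixes T :: "'a::euclidean_space \<Rightarrow> 'a"
  assumes "distr lborel borel T = lborel" "T \<in> borel_measurable borel" "AE x in lborel. P x"
  shows "AE x in lborel. P (T x)"
  using AE_distrD[of T lborel borel P, unfolded assms(1)] assms(2,3) by simp

text \<open>Transfers integrals between \<^const>\<open>lebesgue\<close> and \<^const>\<open>lborel\<close>. Fubini's theorem is applied to Borel representatives, since
  \<open>(x, h) \<mapsto> u (x + h)\<close> is in general not measurable for the product of the completed \<open>\<sigma>\<close>-algebras.\<close>
lemma lebesgue_integral_AE_eq:
  fixes f g :: "'a::euclidean_space \<Rightarrow> real"
  assumes g: "integrable lborel g" and eq: "AE x in lborel. f x = g x"
  shows "integrable lebesgue f" "(LINT x|lebesgue. f x) = (LINT x|lborel. g x)"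
proof -
  have gm: "g \<in> borel_measurable lborel" using g by simp
  have eq': "AE x in lebesgue. g x = f x" using AE_completion[OF eq] by eventually_elim simp
  have fm: "f \<in> borel_measurable lebesgue"
  proof (rule measurableI)
    fix A :: "real set" assume A: "A \<in> sets borel"
    have "g -` A \<in> sets lebesgue"
      using measurable_sets[OF measurable_completion[OF gm] A] by simp
    note sets = this
    have "AE x in lebesgue. x \<in> g -` A \<longleftrightarrow> x \<in> f -` A"
      using eq' by (auto elim: eventually_mono)
    from completion.in_sets_AE[OF this sets] show "f -` A \<inter> space lebesgue \<in> sets lebesgue"
      by simp
  qed simp
  have gl: "integrable lebesgue g" using g integrable_completion[OF gm] by simp
  show "integrable lebesgue f"
    by (rule integrable_cong_AE_imp[OF gl fm]) (use eq' in \<open>auto elim: eventually_mono\<close>)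
  have "(LINT x|lebesgue. f x) = (LINT x|lebesgue. g x)"
    by (rule integral_cong_AE[OF fm measurable_completion[OF gm]]) (use eq' in \<open>auto elim: eventually_mono\<close>)
  also have "\<dots> = (LINT x|lborel. g x)" by (rule integral_completion[OF gm])
  finally show "(LINT x|lebesgue. f x) = (LINT x|lborel. g x)" .
qed

lemma borel_representative:
  fixes f :: "'a::euclidean_space \<Rightarrow> real"
  assumes f: "integrable lebesgue f"
  obtains g where "integrable lborel g" "AE x in lborel. f x = g x"
proof -
  obtain g where g: "g \<in> borel_measurable lborel" "AE x in lborel. f x = g x"
    using completion_ex_borel_measurable_real[OF borel_measurable_integrable[OF f]] by blast
  have "integrable lebesgue g"
    by (rule integrable_cong_AE_imp[OF f measurable_completion[OF g(1)]]) (rule AE_completion[OF g(2)])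
  then show ?thesis using that g integrable_completion[OF g(1)] by blast
qed

lemma matrix_integral_component:
  fixes F :: "'a \<Rightarrow> real^'n::finite^'n"
  assumes "\<And>i j. integrable M (\<lambda>x. F x $ i $ j)"
  shows "integrable M F" "(LINT x|M. F x) $ i $ j = (LINT x|M. F x $ i $ j)"
proof -
  have "F x = (\<Sum>i\<in>UNIV. \<Sum>j\<in>UNIV. F x $ i $ j *\<^sub>R axis i (axis j 1))" for x
  proof -
    have 1: "(F x $ i $ j *\<^sub>R axis i (axis j (1::real))) $ a $ b = (if a = i then if b = j then F x $ i $ j else 0 else 0)"
      for a b i j by (simp add: axis_def)
    have 2: "(\<Sum>j\<in>UNIV. if a = i then if b = j then F x $ i $ j else 0 else 0) = (if a = i then F x $ i $ b else 0)"
      for a b i by simp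
    show ?thesis unfolding vec_eq_iff sum_component 1 2 by simp
  qed
  moreover have "integrable M (\<lambda>x. \<Sum>i\<in>UNIV. \<Sum>j\<in>UNIV. F x $ i $ j *\<^sub>R (axis i (axis j 1) :: real^'n^'n))"
    using assms by simp
  ultimately show int: "integrable M F" by presburger
  have "bounded_linear (\<lambda>A::real^'n^'n. A $ i $ j)"
    by (intro bounded_linear_compose[OF bounded_linear_vec_nth] bounded_linear_vec_nth)
  from integral_bounded_linear[OF this int]
  show "(LINT x|M. F x) $ i $ j = (LINT x|M. F x $ i $ j)" by simp
qed

text \<open>Integration by parts twice, once in each defining condition, with \<open>\<partial>\<^sub>j \<psi>\<close> as the test function in the first.\<close>
lemma hessian_measure_pairing:
  assumes g: "has_weak_gradient u g" and D: "has_derivative_measure g D"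
    and \<psi>: "\<psi> \<in> test_functions"
  shows "(LINT x|lebesgue. u x * partial_deriv i (partial_deriv j \<psi>) x) = signed_integral (\<lambda>A. D A $ i $ j) \<psi>"
proof -
  have "(LINT x|lebesgue. u x * partial_deriv i (partial_deriv j \<psi>) x) = - (LINT x|lebesgue. g x $ i * partial_deriv j \<psi> x)"
    using g test_function_partial_deriv[OF \<psi>] unfolding has_weak_gradient_def by blast
  also have "(LINT x|lebesgue. g x $ i * partial_deriv j \<psi> x) = - signed_integral (\<lambda>A. D A $ i $ j) \<psi>"
    using D \<psi> unfolding has_derivative_measure_def by blast
  finally show ?thesis by simp
qed

lemma finite_radon_measure_component:
  fixes D :: "(real^'n::finite) set \<Rightarrow> real^'n^'n"
  assumes "finite_radon_measure D"
  shows "finite_radon_measure (\<lambda>A. D A $ i $ j)"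
proof -
  have "bounded_linear (\<lambda>A::real^'n^'n. A $ i $ j)"
    by (intro bounded_linear_compose[OF bounded_linear_vec_nth] bounded_linear_vec_nth)
  from bounded_linear.sums[OF this] show ?thesis
    using assms unfolding finite_radon_measure_def by blast
qed

theorem theorem1p6:
  fixes \<rho> :: "nat \<Rightarrow> real^'n::finite \<Rightarrow> real"
    and u :: "real^'n \<Rightarrow> real"
    and D2u :: "(real^'n) set \<Rightarrow> real^'n^'n"
  assumes radial: "\<And>n x y. norm x = norm y \<Longrightarrow> \<rho> n x = \<rho> n y"
    and nonneg: "\<And>n x. \<rho> n x \<ge> 0"
    and integrable: "\<And>n. integrable lebesgue (\<rho> n)"
    and mass: "\<And>n. (LINT x|lebesgue. \<rho> n x) = 1"
    and concentration:
      "\<And>\<gamma>. \<gamma> > 0 \<Longrightarrow> (\<lambda>n. LINT x:{x. norm x > \<gamma>}|lebesgue. \<rho> n x) \<longlonglongrightarrow> 0"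
    and u: "u \<in> BV2"
    and D2u: "has_hessian_measure u D2u"
  shows "(\<forall>n. (AE x in lebesgue. integrable lebesgue (hessian_integrand (\<rho> n) u x)) \<and>
              integrable lebesgue (nonlocal_hessian (\<rho> n) u)) \<and>
         (\<forall>\<phi>\<in>C0_matrix.
            (\<lambda>n. LINT x|lebesgue. nonlocal_hessian (\<rho> n) u x \<bullet> \<phi> x)
              \<longlonglongrightarrow> matrix_integral D2u \<phi>)"
proof -
  obtain g where g: "has_weak_gradient u g" and D: "has_derivative_measure g D2u"
    using D2u unfolding has_hessian_measure_def by blast
  obtain v where v: "integrable lborel v" "AE x in lborel. u x = v x"
    using borel_representative[of u] g unfolding has_weak_gradient_def by blast
  let ?D = "\<lambda>i j A. D2u A $ i $ j"
  have pairing: "(LINT x|lborel. v x * partial_deriv i (partial_deriv j \<psi>) x) = signed_integral (?D i j) \<psi>"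
    if \<psi>: "\<psi> \<in> test_functions" for \<psi> i j
  proof -
    note t = test_function_partial_deriv[OF test_function_partial_deriv[OF \<psi>], of i j]
    obtain B where B: "\<And>x. \<bar>partial_deriv i (partial_deriv j \<psi>) x\<bar> \<le> B"
      using test_function_bounded[OF t] by metis
    have "partial_deriv i (partial_deriv j \<psi>) \<in> borel_measurable lborel"
      using test_function_borel[OF t] by simp
    then have "integrable lborel (\<lambda>x. v x * partial_deriv i (partial_deriv j \<psi>) x)"
      by (rule integrable_mult_bounded[OF v(1) _ B])
    then have "(LINT x|lebesgue. u x * partial_deriv i (partial_deriv j \<psi>) x) = (LINT x|lborel. v x * partial_deriv i (partial_deriv j \<psi>) x)"
      by (rule lebesgue_integral_AE_eq(2)) (use v(2) in \<open>auto elim: eventually_mono\<close>)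
    then show ?thesis using hessian_measure_pairing[OF g D \<psi>] by simp
  qed
  have radon: "finite_radon_measure D2u" using D unfolding has_derivative_measure_def by blast
  have "\<exists>C\<ge>0. \<forall>i j f f' e. f \<in> borel_measurable borel \<longrightarrow> f' \<in> borel_measurable borel \<longrightarrow>
     bounded (range f) \<longrightarrow> bounded (range f') \<longrightarrow> (\<forall>x. \<bar>f x - f' x\<bar> \<le> e) \<longrightarrow>
     \<bar>signed_integral (?D i j) f - signed_integral (?D i j) f'\<bar> \<le> C * e"
  proof -
    obtain c where c: "\<And>i j. c i j \<ge> 0"
      and lip: "\<And>i j f f' e. f \<in> borel_measurable borel \<Longrightarrow> f' \<in> borel_measurable borel \<Longrightarrow>
        bounded (range f) \<Longrightarrow> bounded (range f') \<Longrightarrow> (\<forall>x. \<bar>f x - f' x\<bar> \<le> e) \<Longrightarrow>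
        \<bar>signed_integral (?D i j) f - signed_integral (?D i j) f'\<bar> \<le> c i j * e"
      using signed_integral_lipschitz[OF finite_radon_measure_component[OF radon]] by metis
    let ?C = "\<Sum>i\<in>UNIV. \<Sum>j\<in>UNIV. c i j"
    have le: "c i j \<le> ?C" for i j
      using member_le_sum[of j UNIV "c i"] member_le_sum[of i UNIV "\<lambda>i. \<Sum>j\<in>UNIV. c i j"] c
      by (fastforce simp: sum_nonneg intro: order_trans)
    have "\<bar>signed_integral (?D i j) f - signed_integral (?D i j) f'\<bar> \<le> ?C * e"
      if "f \<in> borel_measurable borel" "f' \<in> borel_measurable borel"
        "bounded (range f)" "bounded (range f')" and e: "\<forall>x. \<bar>f x - f' x\<bar> \<le> e" for i j f f' e
    proof -
      have "0 \<le> e" using e[rule_format, of 0] by linarith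
      then show ?thesis using lip[OF that, of i j] mult_right_mono[OF le[of i j]] by fastforce
    qed
    moreover have "0 \<le> ?C" using c by (simp add: sum_nonneg)
    ultimately show ?thesis by blast
  qed
  then obtain C where C: "C \<ge> 0"
    and lip: "\<And>i j f f' e. f \<in> borel_measurable borel \<Longrightarrow> f' \<in> borel_measurable borel \<Longrightarrow>
        bounded (range f) \<Longrightarrow> bounded (range f') \<Longrightarrow> (\<And>x. \<bar>f x - f' x\<bar> \<le> e) \<Longrightarrow>
        \<bar>signed_integral (?D i j) f - signed_integral (?D i j) f'\<bar> \<le> C * e"
    by metis
  have test_bounded: "bounded (range \<psi>)" if "\<psi> \<in> test_functions" for \<psi> :: "real^'n \<Rightarrow> real"
    using test_function_bounded[OF that] unfolding bounded_iff by (metis rangeE real_norm_def)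
  \<comment> \<open>the Lipschitz constant \<open>C\<close> in the normalization of the locale\<close>
  define K where "K = 2 * (real CARD('n))\<^sup>2 * C"
  interpret weak: weak_hessian v K
  proof
    show "0 \<le> K" using C by (simp add: K_def)
    show "\<bar>(LINT x|lborel. v x * partial_deriv i (partial_deriv j \<psi>) x)
        - (LINT x|lborel. v x * partial_deriv i (partial_deriv j \<psi>') x)\<bar> \<le> K / (2 * (real CARD('n))\<^sup>2) * e"
      if \<psi>: "\<psi> \<in> test_functions" "\<psi>' \<in> test_functions" and e: "\<And>x. \<bar>\<psi> x - \<psi>' x\<bar> \<le> e" for \<psi> \<psi>' i j e
    proof -
      have "K / (2 * (real CARD('n))\<^sup>2) = C" by (simp add: K_def)
      then show ?thesis unfolding pairing[OF \<psi>(1)] pairing[OF \<psi>(2)]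
        using lip[OF test_function_borel[OF \<psi>(1)] test_function_borel[OF \<psi>(2)] test_bounded[OF \<psi>(1)] test_bounded[OF \<psi>(2)] e]
        by simp
    qed
  qed (rule v(1))
  have "\<exists>r. integrable lborel r \<and> (\<forall>x. 0 \<le> r x) \<and> (AE x in lborel. \<rho> n x = r x)" for n
  proof -
    obtain s where s: "integrable lborel s" "AE x in lborel. \<rho> n x = s x"
      using borel_representative[OF integrable] by blast
    \<comment> \<open>the representative must be nonnegative everywhere\<close>
    have "AE x in lborel. \<rho> n x = max 0 (s x)"
      using s(2) by eventually_elim (metis nonneg max.absorb2)
    then show ?thesis using s(1) by (intro exI[of _ "\<lambda>x. max 0 (s x)"]) auto
  qed
  then obtain r where r: "\<And>n. integrable lborel (r n)" "\<And>n x. 0 \<le> r n x" "\<And>n. AE x in lborel. \<rho> n x = r n x"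
    by metis
  have r_mass: "(LINT x|lborel. r n x) = 1" for n
    using lebesgue_integral_AE_eq(2)[OF r(1,3)] mass[of n] by simp
  have moll: "weak_hessian_mollified v K (r n)" for n
    by (unfold_locales) (rule r r_mass)+
  have inv: "AE h in lborel. r n (T h) = r n h" if T: "orthogonal_transformation T" for n T
  proof -
    have "AE h in lborel. \<rho> n (T h) = r n (T h)"
      by (rule AE_lborel_invariant[OF lborel_orthogonal_transformation[OF T] orthogonal_transformation_measurable[OF T] r(3)])
    with r(3)[of n] show ?thesis
    proof eventually_elim
      case (elim h)
      then show ?case using radial[of "T h" h n] orthogonal_transformation_norm[OF T] by simp
    qed
  qed
  have conc: "(\<lambda>n. LINT h|lborel. indicator {h. norm h > \<gamma>} h * r n h) \<longlonglongrightarrow> 0" if \<gamma>: "\<gamma> > 0" for \<gamma>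
  proof -
    have "(LINT x:{x. norm x > \<gamma>}|lebesgue. \<rho> n x) = (LINT h|lborel. indicator {h. norm h > \<gamma>} h * r n h)" for n
      unfolding set_lebesgue_integral_def
    proof (rule lebesgue_integral_AE_eq(2))
      have "integrable lborel (\<lambda>h. r n h * indicator {h. norm h > \<gamma>} h)"
        by (rule integrable_mult_bounded[OF r(1), where K = 1]) (auto simp: indicator_def)
      then show "integrable lborel (\<lambda>h. indicator {h. norm h > \<gamma>} h * r n h)" by (simp add: mult.commute)
      show "AE h in lborel. indicator {h. norm h > \<gamma>} h *\<^sub>R \<rho> n h = indicator {h. norm h > \<gamma>} h * r n h"
        using r(3)[of n] by (auto elim: eventually_mono)
    qed
    then show ?thesis using concentration[OF \<gamma>] by simp
  qed
  let ?c = "real CARD('n) * (real CARD('n) + 2) / 2"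
  let ?H = "\<lambda>n. weak_hessian_mollified.nonlocal_entry v (r n)"
  have rep: "AE x in lborel. integrable lebesgue (hessian_integrand (\<rho> n) u x)
      \<and> (\<forall>i j. nonlocal_hessian (\<rho> n) u x $ i $ j = ?H n i j x)" for n
  proof -
    interpret m: weak_hessian_mollified v K "r n" by (rule moll)
    have "AE x in lborel. \<forall>i\<in>UNIV. \<forall>j\<in>UNIV. integrable lborel (\<lambda>h. m.nonlocal_term i j h x)"
      by (intro AE_finite_allI finite_UNIV m.nonlocal_term_AE_integrable) auto
    with v(2) show ?thesis
    proof eventually_elim
      case (elim x)
      have plus: "AE h in lborel. u (x + h) = v (x + h)"
        by (rule AE_lborel_invariant[OF lborel_distr_plus _ v(2)]) simp
      have minus: "AE h in lborel. u (x - h) = v (x - h)"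
        using AE_lborel_invariant[OF lborel_reflect _ plus] by simp
      have eq: "AE h in lborel. hessian_integrand (\<rho> n) u x h $ i $ j = m.nonlocal_term i j h x" for i j
        using plus minus r(3)[of n]
        by eventually_elim (simp add: hessian_integrand_component m.nonlocal_term_def second_difference_def elim(1))
      have int: "integrable lebesgue (\<lambda>h. hessian_integrand (\<rho> n) u x h $ i $ j)"
        and val: "(LINT h|lebesgue. hessian_integrand (\<rho> n) u x h $ i $ j) = (LINT h|lborel. m.nonlocal_term i j h x)" for i j
        using lebesgue_integral_AE_eq[OF _ eq[of i j]] elim(2) by auto
      show ?case
        using matrix_integral_component[OF int] by (simp add: nonlocal_hessian_def m.nonlocal_entry_def val)
    qed
  qed
  have H_int: "integrable lborel (?H n i j)" for n i j
    by (rule weak_hessian_mollified.nonlocal_entry_integrable[OF moll])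
  have comp: "AE x in lborel. nonlocal_hessian (\<rho> n) u x $ i $ j = ?H n i j x" for n i j
    using rep[of n] by (auto elim: eventually_mono)
  have 1: "AE x in lebesgue. integrable lebesgue (hessian_integrand (\<rho> n) u x)" for n
    using AE_completion[OF rep[of n]] by (auto elim: eventually_mono)
  have 2: "integrable lebesgue (nonlocal_hessian (\<rho> n) u)" for n
    by (rule matrix_integral_component(1)) (rule lebesgue_integral_AE_eq(1)[OF H_int comp])
  have 3: "(\<lambda>n. LINT x|lebesgue. nonlocal_hessian (\<rho> n) u x \<bullet> \<phi> x) \<longlonglongrightarrow> matrix_integral D2u \<phi>"
    if \<phi>: "\<phi> \<in> C0_matrix" for \<phi>
  proof -
    let ?f = "\<lambda>i j x. \<phi> x $ i $ j"
    have f: "continuous_on UNIV (?f i j)" "(?f i j \<longlongrightarrow> 0) at_infinity" for i j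
    proof -
      show "continuous_on UNIV (?f i j)"
        using \<phi> unfolding C0_matrix_def by (auto intro!: continuous_intros)
      have "(?f i j \<longlongrightarrow> (0 :: real^'n^'n) $ i $ j) at_infinity"
        by (intro tendsto_vec_nth) (use \<phi> in \<open>simp add: C0_matrix_def\<close>)
      then show "(?f i j \<longlongrightarrow> 0) at_infinity" by simp
    qed
    have fm: "?f i j \<in> borel_measurable borel" for i j
      by (rule borel_measurable_continuous_onI[OF f(1)])
    have fb: "bounded (range (?f i j))" for i j
    proof -
      obtain \<psi> where \<psi>: "\<psi> \<in> test_functions" "\<And>x. \<bar>\<psi> x - ?f i j x\<bar> \<le> 1"
        using test_functions_dense_C0[OF f zero_less_one] by metis
      obtain B where B: "\<And>x. \<bar>\<psi> x\<bar> \<le> B" using test_function_bounded[OF \<psi>(1)] by metis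
      have "\<bar>?f i j x\<bar> \<le> B + 1" for x using \<psi>(2)[of x] B[of x] by linarith
      then show ?thesis unfolding bounded_iff by auto
    qed
    have lim: "(\<lambda>n. LINT x|lborel. ?H n i j x * ?f i j x) \<longlonglongrightarrow> signed_integral (?D i j) (?f i j)" for i j
    proof (rule weak.nonlocal_hessian_converges[OF moll inv conc f C])
      fix \<psi> e assume \<psi>: "\<psi> \<in> test_functions" and e: "\<And>x. \<bar>\<psi> x - ?f i j x\<bar> \<le> e"
      show "\<bar>weak.hess i j \<psi> - signed_integral (?D i j) (?f i j)\<bar> \<le> C * e"
        unfolding weak.hess_def pairing[OF \<psi>]
        by (rule lip[OF test_function_borel[OF \<psi>] fm test_bounded[OF \<psi>] fb e])
    qed
    have "(LINT x|lebesgue. nonlocal_hessian (\<rho> n) u x \<bullet> \<phi> x) = (\<Sum>i\<in>UNIV. \<Sum>j\<in>UNIV. LINT x|lborel. ?H n i j x * ?f i j x)" for n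
    proof -
      obtain B where B: "\<And>i j x. \<bar>?f i j x\<bar> \<le> B i j"
        using fb unfolding bounded_iff by (metis rangeI real_norm_def)
      have i: "integrable lborel (\<lambda>x. ?H n i j x * ?f i j x)" for i j
        by (rule integrable_mult_bounded[OF H_int _ B]) (use fm in simp)
      have ae: "AE x in lborel. nonlocal_hessian (\<rho> n) u x $ i $ j * ?f i j x = ?H n i j x * ?f i j x" for i j
        using comp[of n i j] by (auto elim: eventually_mono)
      note L = lebesgue_integral_AE_eq[OF i ae]
      have "(LINT x|lebesgue. nonlocal_hessian (\<rho> n) u x \<bullet> \<phi> x) =
        (LINT x|lebesgue. (\<Sum>i\<in>UNIV. \<Sum>j\<in>UNIV. nonlocal_hessian (\<rho> n) u x $ i $ j * ?f i j x))"
        by (simp add: inner_vec_def)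
      also have "\<dots> = (\<Sum>i\<in>UNIV. \<Sum>j\<in>UNIV. LINT x|lborel. ?H n i j x * ?f i j x)"
        using L by simp
      finally show ?thesis .
    qed
    then show ?thesis
      unfolding matrix_integral_def by (simp only:) (intro tendsto_sum lim)
  qed
  show ?thesis using 1 2 3 by blast
qed

end
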